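(* Let $n\ge 1$ be an integer and let $a<b$ be real numbers. Let $A(x,t,u)$ be an $n\times n$ real matrix and $h(x,t,u)\in\mathbb{R}^n$, both defined for $x\in\mathbb{R}$, $t\in\mathbb{R}_+=[0,\infty)$, $u\in\mathbb{R}^n$, and let $\bar u:[a,b]\to\mathbb{R}^n$. Assume that: (i) for every $(x,t,u)$ the matrix $A(x,t,u)$ is diagonal, $A(x,t,u)=\mathrm{diag}(\lambda_1(x,t,u),\dots,\lambda_n(x,t,u))$, and has $n$ real distinct eigenvalues (that is, $\lambda_1(x,t,u),\dots,\lambda_n(x,t,u)$ are real and pairwise distinct); (ii) $A$ and $h$ are continuously differentiable with respect to all variables $(x,t,u)$, and their first-order derivatives are locally Lipschitz continuous with respect to all variables; (iii) $\bar u$ is continuously differentiable on $[a,b]$. Then there exist constants $\Lambda>0$ and $T>0$ and a continuously differentiable function $u:\mathcal{D}\to\mathbb{R}^n$ which is the unique classical solution, on the domain $$\mathcal{D}=\mathcal{D}_{\Lambda,T}:=\{(x,t):\ t\in[0,T],\ a+\Lambda t\le x\le b-\Lambda t\},$$ of the initial value problem $$u_t+A(x,t,u)\,u_x=h(x,t,u),\qquad u(x,0)=\bar u(x)\ \text{ for } x\in[a,b].$$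
   Context: A classical solution on $\mathcal{D}$ is a continuously differentiable function $u:\mathcal{D}\to\mathbb{R}^n$ that satisfies the differential equation pointwise on $\mathcal{D}$ and satisfies $u(x,0)=\bar u(x)$ for all $x\in[a,b]$. Here $\mathcal{D}$ is a closed set, and continuous differentiability on $\mathcal{D}$ is understood as: $u$ is continuous on $\mathcal{D}$, is $C^1$ in the interior, and its first partial derivatives extend continuously to $\mathcal{D}$. Uniqueness means that any two classical solutions on $\mathcal{D}$ coincide. *)

theory Defs
  imports "HOL-Analysis.Analysis"
begin

(* g is the first partial derivative of f in the direction b on the interior of D, extended
   continuously to D.  If D is contained in the closure of its interior (as are all the sets D
   to which this is applied here), then g is uniquely determined on D by D, f and b. *)
definition has_partial_on ::
  "'a::euclidean_space set \<Rightarrow> ('a \<Rightarrow> 'b::real_normed_vector) \<Rightarrow> 'a \<Rightarrow> ('a \<Rightarrow> 'b) \<Rightarrow> bool" where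
  "has_partial_on D f b g \<longleftrightarrow>
     continuous_on D g \<and>
     (\<forall>p\<in>interior D. ((\<lambda>s. f (p + s *\<^sub>R b)) has_vector_derivative g p) (at 0))"

(* Continuous differentiability on a closed set D: values of f outside D play no role. *)
definition C1_on ::
  "'a::euclidean_space set \<Rightarrow> ('a \<Rightarrow> 'b::real_normed_vector) \<Rightarrow> bool" where
  "C1_on D f \<longleftrightarrow> continuous_on D f \<and> (\<forall>b\<in>Basis. \<exists>g. has_partial_on D f b g)"

(* The library's local_lipschitz treats functions of two arguments and is Lipschitz in the
   second argument only; here the Lipschitz bound is joint in all variables. *)
definition locally_lipschitz_on ::
  "'a::metric_space set \<Rightarrow> ('a \<Rightarrow> 'b::metric_space) \<Rightarrow> bool" where
  "locally_lipschitz_on D g \<longleftrightarrow>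
     (\<forall>p\<in>D. \<exists>r>0. \<exists>L. L-lipschitz_on (cball p r \<inter> D) g)"

definition loc_lipschitz_partials_on ::
  "'a::euclidean_space set \<Rightarrow> ('a \<Rightarrow> 'b::real_normed_vector) \<Rightarrow> bool" where
  "loc_lipschitz_partials_on D f \<longleftrightarrow>
     (\<forall>b\<in>Basis. \<forall>g. has_partial_on D f b g \<longrightarrow> locally_lipschitz_on D g)"

definition diag_mat :: "('n \<Rightarrow> real) \<Rightarrow> real^'n^'n" where
  "diag_mat d = (\<chi> i j. if i = j then d i else 0)"

(* The points (x, t, u) with t \<ge> 0. *)
definition coeff_dom :: "(real \<times> real \<times> (real^'n)) set" where
  "coeff_dom = UNIV \<times> {0..} \<times> UNIV"

definition det_dom :: "real \<Rightarrow> real \<Rightarrow> real \<Rightarrow> real \<Rightarrow> (real \<times> real) set" where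
  "det_dom a b \<Lambda> T = {(x, t). t \<in> {0..T} \<and> a + \<Lambda> * t \<le> x \<and> x \<le> b - \<Lambda> * t}"

(* Points of the domain are pairs (x, t), so (1, 0) and (0, 1) are the x- and t-directions;
   at boundary points of D the equation is satisfied by the extended derivatives. *)
definition classical_solution ::
  "real \<Rightarrow> real \<Rightarrow> (real \<times> real) set \<Rightarrow>
   (real \<times> real \<times> (real^'n) \<Rightarrow> real^'n^'n) \<Rightarrow> (real \<times> real \<times> (real^'n) \<Rightarrow> real^'n) \<Rightarrow>
   (real \<Rightarrow> real^'n) \<Rightarrow> (real \<times> real \<Rightarrow> real^'n) \<Rightarrow> bool" where
  "classical_solution a b D A h ubar u \<longleftrightarrow>
     C1_on D u \<and>
     (\<exists>ux ut. has_partial_on D u (1, 0) ux \<and> has_partial_on D u (0, 1) ut \<and>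
        (\<forall>(x, t)\<in>D. ut (x, t) + A (x, t, u (x, t)) *v ux (x, t) = h (x, t, u (x, t)))) \<and>
     (\<forall>x\<in>{a..b}. u (x, 0) = ubar x)"

end

theory Submission
  imports Defs
begin

text \<open>
  The system is diagonal, so its \<open>i\<close>-th equation is an ordinary differential equation for \<open>u\<^sub>i\<close>
  along the curves \<open>X' = \<lambda>\<^sub>i(X, s, u(X, s))\<close>, the characteristics of the \<open>i\<close>-th family. A solution is
  therefore a fixed point of the map that sends \<open>u\<close> to the function with components
  \<open>f\<^sub>i(X 0) + (\<integral>\<^bsub>0\<^esub>\<^bsup>t\<^esup> h\<^sub>i(X s, s, u(X s, s)) ds)\<close>, where \<open>X\<close> is the characteristic of \<open>u\<close> through \<open>(x, t)\<close> and
  \<open>f\<close> is the initial datum. For small times this map is a contraction, in the supremum norm, of the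
  set of functions that are Lipschitz in \<open>x\<close> with a fixed constant (\<open>ex_transport_fixed_point\<close>).

  The fixed point is Lipschitz in \<open>x\<close>; the point is to see that it is \<open>C\<^sup>1\<close> although the initial datum
  is no better than \<open>C\<^sup>1\<close>. This is read off from its difference quotients
  \<open>q(x, y) = (u(x) - u(y)) / (x - y)\<close>, without differentiating the flow. Along two
  characteristics of the \<open>i\<close>-th family, \<open>q\<^sub>i\<close> obeys a Riccati equation up to an error that vanishes
  with the distance of the curves. Comparing \<open>q(x, y)\<close> with \<open>q(x, z)\<close> over a short time interval
  shows: if they differ by at most \<open>c\<close> for all \<open>y\<close>, \<open>z\<close> near \<open>x\<close>, then they differ by at most \<open>3/4 c\<close>
  for all \<open>y\<close>, \<open>z\<close> still closer to \<open>x\<close> (\<open>oscillation_shrinks\<close>). Iteration makes the quotients uniformly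
  Cauchy as \<open>y\<close> tends to \<open>x\<close>, so that \<open>u\<^sub>x\<close> exists as a uniform limit and is continuous
  (\<open>slope_uniform\<close>). The derivative in time, and with it the differential equation, follows by
  comparing \<open>u\<close> at a fixed place with \<open>u\<close> along a characteristic (\<open>time_derivative\<close>).

  All this is done for coefficients on the whole space that are bounded and uniformly differentiable
  in \<open>(x, u)\<close>. The given ones are brought to this form by composing them with a smooth bounded map
  that is the identity on a large ball (\<open>global_coefficient\<close>); the ball contains all the states that
  the solution takes on the domain of determinacy, where the truncation is therefore invisible.

  For uniqueness, any classical solution \<open>v\<close> is compared with the constructed \<open>u\<close>, along the
  characteristics of \<open>u\<close>. If \<open>\<Lambda>\<close> exceeds the speed bound for \<open>u\<close>, these stay in the domain backwards in
  time, whatever the speeds that belong to \<open>v\<close>. The difference satisfies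
  \<open>(v - u)\<^sub>i' = O(norm (v - u))\<close> there, because \<open>v\<^sub>x\<close> is bounded on the compact domain, and a Gronwall
  argument with an exponential weight makes it vanish (\<open>classical_solution_unique\<close>).
\<close>

section \<open>Continuous partial derivatives\<close>

lemma vector_increment_bound:
  fixes f :: "real \<Rightarrow> 'b::real_normed_vector"
  assumes "\<And>r. r \<in> S \<Longrightarrow> (f has_vector_derivative f' r) (at r within S)"
    and "\<And>r. r \<in> S \<Longrightarrow> norm (f' r) \<le> B"
    and "convex S" "s \<in> S" "t \<in> S"
  shows "norm (f s - f t) \<le> B * \<bar>s - t\<bar>"
proof -
  have "norm (f s - f t) \<le> B * norm (s - t)"
  proof (rule differentiable_bound[OF \<open>convex S\<close>])
    show "(f has_derivative (\<lambda>x. x *\<^sub>R f' r)) (at r within S)" if "r \<in> S" for r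
      using assms(1)[OF that] by (simp add: has_vector_derivative_def)
    show "onorm (\<lambda>x. x *\<^sub>R f' r) \<le> B" if "r \<in> S" for r
      using assms(2)[OF that] by (intro onorm_le) (simp add: mult.commute[of B] mult_left_mono)
  qed (use assms in auto)
  then show ?thesis by simp
qed

text \<open>
  The increment from \<open>z\<close> to \<open>z + v\<close> is split into steps parallel to the axes; the mean value theorem
  on each step costs the oscillation \<open>e\<close> of one partial derivative. The hypothesis on \<open>U\<close> says that
  \<open>U\<close> contains the box around \<open>z\<close> with half-widths \<open>\<bar>v \<bullet> b\<bar>\<close>, where all the steps take place.
\<close>

lemma partials_telescope:
  fixes f :: "'a::euclidean_space \<Rightarrow> 'b::real_normed_vector"
  assumes "finite J" "J \<subseteq> Basis"
    and der: "\<And>y b. b \<in> Basis \<Longrightarrow> y \<in> U \<Longrightarrow>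
        ((\<lambda>s. f (y + s *\<^sub>R b)) has_vector_derivative g b y) (at 0)"
    and near: "\<And>y b. b \<in> Basis \<Longrightarrow> y \<in> U \<Longrightarrow> norm (g b y - g b z) \<le> e"
    and U: "\<And>y. (\<And>b. b \<in> Basis \<Longrightarrow> \<bar>(y - z) \<bullet> b\<bar> \<le> \<bar>v \<bullet> b\<bar>) \<Longrightarrow> y \<in> U"
  shows "norm (f (z + (\<Sum>b\<in>J. (v \<bullet> b) *\<^sub>R b)) - f z - (\<Sum>b\<in>J. (v \<bullet> b) *\<^sub>R g b z))
          \<le> e * (\<Sum>b\<in>J. \<bar>v \<bullet> b\<bar>)"
  using assms(1,2)
proof (induction J rule: finite_induct)
  case empty
  then show ?case by simp
next
  case (insert b J)
  define y where "y = z + (\<Sum>c\<in>J. (v \<bullet> c) *\<^sub>R c)"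
  have b: "b \<in> Basis" and J: "J \<subseteq> Basis" using insert by auto
  have inner: "(y + s *\<^sub>R b - z) \<bullet> c = (if c = b then s else if c \<in> J then v \<bullet> c else 0)"
    if "c \<in> Basis" for c s
  proof -
    have "(\<Sum>d\<in>J. (v \<bullet> d) *\<^sub>R d) \<bullet> c = (\<Sum>d\<in>J. if d = c then v \<bullet> c else 0)"
      unfolding inner_sum_left using J that by (intro sum.cong) (auto simp: inner_Basis)
    also have "\<dots> = (if c \<in> J then v \<bullet> c else 0)" using insert.hyps(1) by simp
    finally show ?thesis
      using that b insert.hyps(2) by (auto simp: y_def inner_left_distrib inner_Basis)
  qed
  \<comment> \<open>the segment of length \<open>v \<bullet> b\<close> in direction \<open>b\<close> that starts at \<open>y\<close> stays in \<open>U\<close>\<close>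
  have seg: "y + s *\<^sub>R b \<in> U" if "s \<in> closed_segment 0 (v \<bullet> b)" for s
  proof (rule U)
    fix c :: 'a assume "c \<in> Basis"
    moreover have "\<bar>s\<bar> \<le> \<bar>v \<bullet> b\<bar>"
      using that by (auto simp: closed_segment_eq_real_ivl split: if_splits)
    ultimately show "\<bar>(y + s *\<^sub>R b - z) \<bullet> c\<bar> \<le> \<bar>v \<bullet> c\<bar>" by (simp add: inner)
  qed
  have "norm ((f (y + (v \<bullet> b) *\<^sub>R b) - (v \<bullet> b) *\<^sub>R g b z) - (f (y + 0 *\<^sub>R b) - 0 *\<^sub>R g b z))
      \<le> e * \<bar>v \<bullet> b - 0\<bar>"
  proof (rule vector_increment_bound[where S = "closed_segment 0 (v \<bullet> b)" and f' = "\<lambda>s. g b (y + s *\<^sub>R b) - g b z"])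
    fix s assume s: "s \<in> closed_segment 0 (v \<bullet> b)"
    have "((\<lambda>r. f (y + s *\<^sub>R b + r *\<^sub>R b)) has_vector_derivative g b (y + s *\<^sub>R b)) (at (s - s))"
      using der[OF b seg[OF s]] by simp
    then have "((\<lambda>r. f (y + s *\<^sub>R b + (r - s) *\<^sub>R b)) has_vector_derivative g b (y + s *\<^sub>R b)) (at s)"
      using vector_diff_chain_at[where f="\<lambda>r. r - s" and f'=1 and x = s
          and g="\<lambda>r. f (y + s *\<^sub>R b + r *\<^sub>R b)" and g'="g b (y + s *\<^sub>R b)"]
      by (simp add: has_vector_derivative_diff_const o_def)
    then have "((\<lambda>r. f (y + r *\<^sub>R b)) has_vector_derivative g b (y + s *\<^sub>R b)) (at s)"
      by (simp add: algebra_simps)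
    moreover have scale: "((\<lambda>s. s *\<^sub>R g b z) has_vector_derivative g b z) (at s)"
      using bounded_linear_imp_has_derivative[OF bounded_linear_scaleR_left]
      by (simp add: has_vector_derivative_def)
    ultimately show "((\<lambda>s. f (y + s *\<^sub>R b) - s *\<^sub>R g b z) has_vector_derivative g b (y + s *\<^sub>R b) - g b z)
        (at s within closed_segment 0 (v \<bullet> b))"
      by (intro has_vector_derivative_at_within[OF has_vector_derivative_diff[OF _ scale]])
    show "norm (g b (y + s *\<^sub>R b) - g b z) \<le> e" using near[OF b seg[OF s]] .
  qed auto
  then have step: "norm (f (y + (v \<bullet> b) *\<^sub>R b) - f y - (v \<bullet> b) *\<^sub>R g b z) \<le> e * \<bar>v \<bullet> b\<bar>"
    by (simp add: algebra_simps)
  have "f (z + (\<Sum>c\<in>insert b J. (v \<bullet> c) *\<^sub>R c)) - f z - (\<Sum>c\<in>insert b J. (v \<bullet> c) *\<^sub>R g c z)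
      = (f (y + (v \<bullet> b) *\<^sub>R b) - f y - (v \<bullet> b) *\<^sub>R g b z)
        + (f y - f z - (\<Sum>c\<in>J. (v \<bullet> c) *\<^sub>R g c z))"
    using insert.hyps by (simp add: y_def algebra_simps)
  also have "norm \<dots> \<le> e * \<bar>v \<bullet> b\<bar> + e * (\<Sum>c\<in>J. \<bar>v \<bullet> c\<bar>)"
    using step insert.IH[OF J] unfolding y_def by (intro norm_triangle_mono)
  finally show ?case using insert.hyps by (simp add: algebra_simps)
qed

lemma continuous_partials_imp_has_derivative:
  fixes f :: "'a::euclidean_space \<Rightarrow> 'b::real_normed_vector"
  assumes part: "\<And>b. b \<in> Basis \<Longrightarrow> has_partial_on D f b (g b)" and z: "z \<in> interior D"
  shows "(f has_derivative (\<lambda>v. \<Sum>b\<in>Basis. (v \<bullet> b) *\<^sub>R g b z)) (at z)"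
  unfolding has_derivative_at_alt
proof (intro conjI allI impI)
  show "bounded_linear (\<lambda>v. \<Sum>b\<in>Basis. (v \<bullet> b) *\<^sub>R g b z)"
    by (intro bounded_linear_sum bounded_linear_intros)
  fix e :: real assume "e > 0"
  define e' where "e' = e / DIM('a)"
  have "e' > 0" using \<open>e > 0\<close> by (simp add: e'_def)
  have "\<forall>\<^sub>F y in nhds z. y \<in> interior D \<and> (\<forall>b\<in>Basis. dist (g b y) (g b z) < e')"
  proof (intro eventually_conj eventually_ball_finite)
    show "\<forall>\<^sub>F y in nhds z. y \<in> interior D" using z by (simp add: eventually_nhds_in_open)
    show "\<forall>b\<in>Basis. \<forall>\<^sub>F y in nhds z. dist (g b y) (g b z) < e'"
    proof
      fix b :: 'a assume "b \<in> Basis"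
      then have "continuous_on D (g b)" using part by (simp add: has_partial_on_def)
      then have "isCont (g b) z" using z by (simp add: continuous_on_interior)
      then show "\<forall>\<^sub>F y in nhds z. dist (g b y) (g b z) < e'"
        using \<open>e' > 0\<close> by (intro tendstoD) (auto simp: isCont_def tendsto_at_iff_tendsto_nhds)
    qed
  qed simp
  then obtain d where "d > 0"
    and d: "\<And>y. dist y z < d \<Longrightarrow> y \<in> interior D \<and> (\<forall>b\<in>Basis. dist (g b y) (g b z) < e')"
    unfolding eventually_nhds_metric by blast
  show "\<exists>d>0. \<forall>y. norm (y - z) < d \<longrightarrow>
      norm (f y - f z - (\<Sum>b\<in>Basis. ((y - z) \<bullet> b) *\<^sub>R g b z)) \<le> e * norm (y - z)"
  proof (intro exI conjI allI impI)
    show "d > 0" by fact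
    fix y assume y: "norm (y - z) < d"
    have "norm (f (z + (\<Sum>b\<in>Basis. ((y - z) \<bullet> b) *\<^sub>R b)) - f z
        - (\<Sum>b\<in>Basis. ((y - z) \<bullet> b) *\<^sub>R g b z)) \<le> e' * (\<Sum>b\<in>Basis. \<bar>(y - z) \<bullet> b\<bar>)"
    proof (rule partials_telescope[where U = "ball z d"])
      show "((\<lambda>s. f (x + s *\<^sub>R b)) has_vector_derivative g b x) (at 0)"
        if "b \<in> Basis" "x \<in> ball z d" for x b
        using d[of x] part[OF that(1)] that by (auto simp: has_partial_on_def dist_commute)
      show "norm (g b x - g b z) \<le> e'" if "b \<in> Basis" "x \<in> ball z d" for x b
        using d[of x] that by (auto simp: dist_commute dist_norm less_imp_le)
      show "x \<in> ball z d" if "\<And>b. b \<in> Basis \<Longrightarrow> \<bar>(x - z) \<bullet> b\<bar> \<le> \<bar>(y - z) \<bullet> b\<bar>" for x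
        using norm_le_componentwise[OF that] y by (simp add: dist_norm norm_minus_commute)
    qed auto
    also have "(\<Sum>b\<in>Basis. ((y - z) \<bullet> b) *\<^sub>R b) = y - z" by (rule euclidean_representation)
    also have "e' * (\<Sum>b\<in>Basis. \<bar>(y - z) \<bullet> b\<bar>) \<le> e' * (DIM('a) * norm (y - z))"
      using \<open>e' > 0\<close> sum_bounded_above[of Basis "\<lambda>b. \<bar>(y - z) \<bullet> b\<bar>" "norm (y - z)"]
      by (intro mult_left_mono) (auto simp: Basis_le_norm)
    also have "\<dots> = e * norm (y - z)" by (simp add: e'_def)
    finally show "norm (f y - f z - (\<Sum>b\<in>Basis. ((y - z) \<bullet> b) *\<^sub>R g b z)) \<le> e * norm (y - z)"
      by simp
  qed
qed

lemma C1_on_bounded_linear: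
  assumes "C1_on D f" "bounded_linear h"
  shows "C1_on D (\<lambda>x. h (f x))"
  unfolding C1_on_def
proof (intro conjI ballI)
  show "continuous_on D (\<lambda>x. h (f x))"
    using assms by (auto simp: C1_on_def intro: bounded_linear.continuous_on)
  fix b :: 'a assume "b \<in> Basis"
  then obtain g where "has_partial_on D f b g" using assms by (auto simp: C1_on_def)
  then have "has_partial_on D (\<lambda>x. h (f x)) b (\<lambda>x. h (g x))"
    unfolding has_partial_on_def
    by (auto intro: bounded_linear.continuous_on[OF assms(2)]
        bounded_linear.has_vector_derivative[OF assms(2)])
  then show "\<exists>g. has_partial_on D (\<lambda>x. h (f x)) b g" by blast
qed

text \<open>
  For real-valued functions the partial derivatives are bundled into one vector field, so that their
  boundedness and uniform continuity on compact sets need no argument for each direction.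
\<close>

lemma C1_on_has_gradient:
  fixes f :: "'a::euclidean_space \<Rightarrow> real"
  assumes "C1_on D f"
  shows "\<exists>G. continuous_on D G \<and> (\<forall>z\<in>interior D. (f has_derivative (\<lambda>v. v \<bullet> G z)) (at z))"
proof -
  obtain g where g: "\<And>b. b \<in> Basis \<Longrightarrow> has_partial_on D f b (g b)"
    using assms unfolding C1_on_def by metis
  have "continuous_on D (\<lambda>z. \<Sum>b\<in>Basis. g b z *\<^sub>R b)"
    using g by (intro continuous_intros) (auto simp: has_partial_on_def)
  moreover have "(f has_derivative (\<lambda>v. v \<bullet> (\<Sum>b\<in>Basis. g b z *\<^sub>R b))) (at z)" if "z \<in> interior D" for z
    using continuous_partials_imp_has_derivative[of D f g, OF g that]
    by (simp add: inner_sum_right mult.commute)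
  ultimately show ?thesis by blast
qed

section \<open>Uniform differentiability\<close>

text \<open>
  Differentiability on \<open>S\<close> with a remainder that is small uniformly in the base point and in a
  parameter \<open>t\<close> (the time), and with bounded derivative. The system is analysed with the smoothness of
  coefficients and data in this form because it makes sense also at the boundary time \<open>t = 0\<close>, where
  only extended partial derivatives are given. Functions without parameter are treated by taking \<open>unit\<close> for \<open>'c\<close>.
\<close>

definition unif_diff_on ::
  "'c set \<Rightarrow> 'a set \<Rightarrow> ('c \<Rightarrow> 'a::real_normed_vector \<Rightarrow> 'b::real_normed_vector) \<Rightarrow>
   ('c \<Rightarrow> 'a \<Rightarrow> 'a \<Rightarrow> 'b) \<Rightarrow> bool" where
  "unif_diff_on I S f f' \<longleftrightarrow>
     (\<exists>L\<ge>0. \<forall>t\<in>I. \<forall>z\<in>S. linear (f' t z) \<and> (\<forall>v. norm (f' t z v) \<le> L * norm v)) \<and>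
     (\<forall>e>0. \<exists>d>0. \<forall>t\<in>I. \<forall>z\<in>S. \<forall>w\<in>S. norm (w - z) < d \<longrightarrow>
        norm (f t w - f t z - f' t z (w - z)) \<le> e * norm (w - z))"

lemma unif_diff_on_has_derivative:
  assumes "unif_diff_on I S f f'" "t \<in> I" "z \<in> S"
  shows "(f t has_derivative f' t z) (at z within S)"
  unfolding has_derivative_within_alt
proof (intro conjI allI impI)
  obtain L where "linear (f' t z)" "\<And>v. norm (f' t z v) \<le> L * norm v"
    using assms unfolding unif_diff_on_def by blast
  then show "bounded_linear (f' t z)"
    by (auto simp: bounded_linear_def bounded_linear_axioms_def mult.commute)
  show "\<exists>d>0. \<forall>y\<in>S. norm (y - z) < d \<longrightarrow> norm (f t y - f t z - f' t z (y - z)) \<le> e * norm (y - z)"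
    if "e > 0" for e
    using assms that unfolding unif_diff_on_def by blast
qed

lemma unif_diff_on_lipschitz:
  assumes "unif_diff_on I S f f'" "convex S"
  shows "\<exists>L\<ge>0. \<forall>t\<in>I. \<forall>z\<in>S. \<forall>w\<in>S. norm (f t z - f t w) \<le> L * norm (z - w)"
proof -
  obtain L where "L \<ge> 0" and L: "\<And>t z v. t \<in> I \<Longrightarrow> z \<in> S \<Longrightarrow> norm (f' t z v) \<le> L * norm v"
    using assms unfolding unif_diff_on_def by blast
  have "onorm (f' t z) \<le> L" if "t \<in> I" "z \<in> S" for t z
    using \<open>L \<ge> 0\<close> L[OF that] by (rule onorm_bound)
  then have "norm (f t z - f t w) \<le> L * norm (z - w)" if "t \<in> I" "z \<in> S" "w \<in> S" for t z w
    using that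
    by (intro differentiable_bound[OF \<open>convex S\<close> unif_diff_on_has_derivative[OF assms(1)]])
  then show ?thesis using \<open>L \<ge> 0\<close> by blast
qed

lemma unif_diff_on_compose:
  assumes f: "unif_diff_on I S f f'" and k: "unif_diff_on UNIV R k k'"
    and maps: "\<And>z. z \<in> R \<Longrightarrow> k () z \<in> S" and R: "convex R"
  shows "unif_diff_on I R (\<lambda>t z. f t (k () z)) (\<lambda>t z v. f' t (k () z) (k' () z v))"
proof -
  obtain L where "L \<ge> 0" and lin: "\<And>t z. t \<in> I \<Longrightarrow> z \<in> S \<Longrightarrow> linear (f' t z)"
    and L: "\<And>t z v. t \<in> I \<Longrightarrow> z \<in> S \<Longrightarrow> norm (f' t z v) \<le> L * norm v"
    using f unfolding unif_diff_on_def by blast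
  obtain K where "K \<ge> 0" and link: "\<And>z. z \<in> R \<Longrightarrow> linear (k' () z)"
    and K: "\<And>z v. z \<in> R \<Longrightarrow> norm (k' () z v) \<le> K * norm v"
    using k unfolding unif_diff_on_def by blast
  obtain M where "M \<ge> 0" and M: "\<And>z w. z \<in> R \<Longrightarrow> w \<in> R \<Longrightarrow> norm (k () z - k () w) \<le> M * norm (z - w)"
    using unif_diff_on_lipschitz[OF k R] by blast
  show ?thesis
    unfolding unif_diff_on_def
  proof (rule conjI, intro conjI exI[of _ "L * K"] ballI allI impI)
    show "0 \<le> L * K" using \<open>L \<ge> 0\<close> \<open>K \<ge> 0\<close> by simp
    fix t z assume "t \<in> I" "z \<in> R"
    show "linear (\<lambda>v. f' t (k () z) (k' () z v))"
      using linear_compose[OF link[OF \<open>z \<in> R\<close>] lin[OF \<open>t \<in> I\<close> maps[OF \<open>z \<in> R\<close>]]] by (simp add: o_def)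
    fix v
    have "norm (f' t (k () z) (k' () z v)) \<le> L * norm (k' () z v)"
      using L \<open>t \<in> I\<close> maps[OF \<open>z \<in> R\<close>] by blast
    also have "\<dots> \<le> L * (K * norm v)" using K \<open>z \<in> R\<close> \<open>L \<ge> 0\<close> by (intro mult_left_mono) auto
    finally show "norm (f' t (k () z) (k' () z v)) \<le> L * K * norm v" by (simp add: mult_ac)
  next
    show "\<forall>e>0. \<exists>d>0. \<forall>t\<in>I. \<forall>z\<in>R. \<forall>w\<in>R. norm (w - z) < d \<longrightarrow>
        norm (f t (k () w) - f t (k () z) - f' t (k () z) (k' () z (w - z))) \<le> e * norm (w - z)"
    proof (intro allI impI)
      fix e :: real assume "e > 0"
      define e1 where "e1 = e / (2 * (M + 1))"
      define e2 where "e2 = e / (2 * (L + 1))"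
      have e12: "e1 > 0" "e2 > 0" "e1 * M \<le> e / 2" "L * e2 \<le> e / 2"
        using \<open>e > 0\<close> \<open>M \<ge> 0\<close> \<open>L \<ge> 0\<close> by (auto simp: e1_def e2_def field_simps)
      obtain d1 where "d1 > 0" and d1: "\<And>t z w. t \<in> I \<Longrightarrow> z \<in> S \<Longrightarrow> w \<in> S \<Longrightarrow> norm (w - z) < d1 \<Longrightarrow>
          norm (f t w - f t z - f' t z (w - z)) \<le> e1 * norm (w - z)"
        using f \<open>e1 > 0\<close> unfolding unif_diff_on_def by blast
      obtain d2 where "d2 > 0" and d2: "\<And>z w. z \<in> R \<Longrightarrow> w \<in> R \<Longrightarrow> norm (w - z) < d2 \<Longrightarrow>
          norm (k () w - k () z - k' () z (w - z)) \<le> e2 * norm (w - z)"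
        using k \<open>e2 > 0\<close> unfolding unif_diff_on_def by blast
      show "\<exists>d>0. \<forall>t\<in>I. \<forall>z\<in>R. \<forall>w\<in>R. norm (w - z) < d \<longrightarrow>
          norm (f t (k () w) - f t (k () z) - f' t (k () z) (k' () z (w - z))) \<le> e * norm (w - z)"
      proof (intro exI[of _ "min d2 (d1 / (M + 1))"] conjI ballI impI)
        show "min d2 (d1 / (M + 1)) > 0" using \<open>d1 > 0\<close> \<open>d2 > 0\<close> \<open>M \<ge> 0\<close> by simp
        fix t z w assume t: "t \<in> I" and z: "z \<in> R" and w: "w \<in> R"
          and d: "norm (w - z) < min d2 (d1 / (M + 1))"
        have "norm (k () w - k () z) \<le> M * norm (w - z)" using M z w by blast
        also have "\<dots> \<le> (M + 1) * norm (w - z)" by (simp add: mult_right_mono)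
        also have "\<dots> < d1" using d \<open>M \<ge> 0\<close> by (simp add: field_simps)
        finally have near: "norm (k () w - k () z) < d1" .
        have "f t (k () w) - f t (k () z) - f' t (k () z) (k' () z (w - z))
            = (f t (k () w) - f t (k () z) - f' t (k () z) (k () w - k () z))
              + f' t (k () z) (k () w - k () z - k' () z (w - z))"
          using linear_diff[OF lin[OF t maps[OF z]]] by simp
        also have "norm \<dots> \<le> e1 * norm (k () w - k () z) + L * norm (k () w - k () z - k' () z (w - z))"
          by (intro norm_triangle_mono d1 L t z w maps near)
        also have "\<dots> \<le> e1 * (M * norm (w - z)) + L * (e2 * norm (w - z))"
          using M z w d2[OF z w] d e12 \<open>L \<ge> 0\<close> by (intro add_mono mult_left_mono) auto
        also have "\<dots> = (e1 * M + L * e2) * norm (w - z)" by (simp add: algebra_simps)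
        also have "\<dots> \<le> e * norm (w - z)" using e12 by (intro mult_right_mono) auto
        finally show "norm (f t (k () w) - f t (k () z) - f' t (k () z) (k' () z (w - z))) \<le> e * norm (w - z)" .
      qed
    qed
  qed
qed

lemma unif_diff_on_subset: "unif_diff_on I S f f' \<Longrightarrow> J \<subseteq> I \<Longrightarrow> unif_diff_on J S f f'"
  unfolding unif_diff_on_def by (meson subsetD)

text \<open>
  The property is monotone in \<open>L\<close>, so finitely many functions have a constant in common.
\<close>

definition common_bound ::
  "'c set \<Rightarrow> 'a set \<Rightarrow> ('c \<Rightarrow> 'a::real_normed_vector \<Rightarrow> 'b::real_normed_vector) \<Rightarrow>
   ('c \<Rightarrow> 'a \<Rightarrow> 'a \<Rightarrow> 'b) \<Rightarrow> real \<Rightarrow> bool" where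
  "common_bound I S f f' L \<longleftrightarrow>
     (\<forall>t\<in>I. \<forall>z\<in>S. (\<forall>v. norm (f' t z v) \<le> L * norm v) \<and> (\<forall>w\<in>S. norm (f t z - f t w) \<le> L * norm (z - w)))"

lemma common_bound_mono: "common_bound I S f f' K \<Longrightarrow> K \<le> L \<Longrightarrow> common_bound I S f f' L"
  unfolding common_bound_def by (meson mult_right_mono norm_ge_zero order_trans)

lemma unif_diff_on_common_bound:
  fixes f :: "'c \<Rightarrow> 'a::real_normed_vector \<Rightarrow> 'b::real_normed_vector"
  assumes ud: "unif_diff_on I S f f'" "convex S"
  shows "\<exists>L\<ge>0. common_bound I S f f' L"
proof -
  obtain L where "L \<ge> 0" and L: "\<forall>t\<in>I. \<forall>z\<in>S. \<forall>v. norm (f' t z v) \<le> L * norm v"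
    using ud unfolding unif_diff_on_def by blast
  obtain K where "K \<ge> 0" and K: "\<forall>t\<in>I. \<forall>z\<in>S. \<forall>w\<in>S. norm (f t z - f t w) \<le> K * norm (z - w)"
    using unif_diff_on_lipschitz[OF ud] by blast
  have "c \<le> L * norm v \<Longrightarrow> c \<le> (L + K) * norm v" "c \<le> K * norm v \<Longrightarrow> c \<le> (L + K) * norm v" for c and v :: "'a"
    using \<open>L \<ge> 0\<close> \<open>K \<ge> 0\<close> by (simp_all add: distrib_right add_increasing add_increasing2)
  then have "common_bound I S f f' (L + K)"
    using L K unfolding common_bound_def by blast
  then show ?thesis using \<open>L \<ge> 0\<close> \<open>K \<ge> 0\<close> by (intro exI[of _ "L + K"]) simp
qed

lemma uniform_bound:
  fixes P :: "'n::finite \<Rightarrow> real \<Rightarrow> bool"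
  assumes "\<And>i. \<exists>L\<ge>0. P i L" "\<And>i L L'. P i L \<Longrightarrow> L \<le> L' \<Longrightarrow> P i L'"
  shows "\<exists>L\<ge>0. \<forall>i. P i L"
proof -
  obtain L where L: "\<And>i. L i \<ge> 0" "\<And>i. P i (L i)" using assms(1) by metis
  have le: "L i \<le> (\<Sum>i\<in>UNIV. L i)" for i using L(1) by (intro member_le_sum) auto
  show ?thesis using L assms(2)[OF L(2) le] by (intro exI[of _ "\<Sum>i\<in>UNIV. L i"]) (auto intro: sum_nonneg)
qed

lemma uniform_radius:
  fixes P :: "'n::finite \<Rightarrow> real \<Rightarrow> bool"
  assumes "\<And>i. \<exists>d>0. P i d" "\<And>i d d'. P i d \<Longrightarrow> 0 < d' \<Longrightarrow> d' \<le> d \<Longrightarrow> P i d'"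
  shows "\<exists>d>0. \<forall>i. P i d"
proof -
  obtain d where d: "\<And>i. d i > 0" "\<And>i. P i (d i)" using assms(1) by metis
  have "Min (range d) > 0" "\<And>i. Min (range d) \<le> d i" using d(1) by auto
  then show ?thesis using assms(2) d(2) by blast
qed

section \<open>Truncated coefficients and extended initial data\<close>

text \<open>
  For \<open>t > 0\<close> the mean value theorem on the segment from \<open>z\<close> to \<open>w\<close> reduces the claim to the uniform
  continuity of the gradient on a compact set. At \<open>t = 0\<close>, where only the extended partial
  derivatives are available, the estimate follows by continuity in \<open>t\<close>.
\<close>

lemma coefficient_unif_diff_on_compact:
  fixes F :: "real \<times> real \<times> (real^'n) \<Rightarrow> real"
  assumes F: "C1_on coeff_dom F" and S: "compact S" "convex S"
  shows "\<exists>F'. unif_diff_on {0..1} S (\<lambda>t z. F (fst z, t, snd z)) F'"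
proof -
  obtain G where contG: "continuous_on coeff_dom G"
    and G: "\<And>p. p \<in> interior coeff_dom \<Longrightarrow> (F has_derivative (\<lambda>v. v \<bullet> G p)) (at p)"
    using C1_on_has_gradient[OF F] by blast
  have contF: "continuous_on coeff_dom F" using F by (simp add: C1_on_def)
  define E where "E = (\<lambda>t (z::real \<times> (real^'n)). (fst z, t::real, snd z))"
  have E_lin: "E 0 (w - z) = E 0 w - E 0 z" "norm (E 0 z) = norm z" for w z
    by (auto simp: E_def norm_Pair norm_prod_def)
  have E_dom: "E t z \<in> coeff_dom" if "t \<ge> 0" for t z
    using that by (auto simp: E_def coeff_dom_def)
  have E_int: "E t z \<in> interior coeff_dom" if "t > 0" for t z
    using that by (auto simp: E_def coeff_dom_def interior_Times)
  define P where "P = (\<lambda>(t, z). E t z) ` ({0..1} \<times> S)"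
  have P: "E t z \<in> P" if "t \<in> {0..1}" "z \<in> S" for t z
    unfolding P_def using that by (intro image_eqI[of _ _ "(t, z)"]) auto
  have "compact P"
    unfolding P_def E_def using S by (intro compact_continuous_image compact_Times)
      (auto intro!: continuous_intros simp: case_prod_beta)
  have "P \<subseteq> coeff_dom" using E_dom by (auto simp: P_def)
  obtain L where L: "\<And>p. p \<in> P \<Longrightarrow> norm (G p) \<le> L"
    using continuous_on_compact_bound[OF \<open>compact P\<close> continuous_on_subset[OF contG \<open>P \<subseteq> coeff_dom\<close>]] by metis
  have ucG: "uniformly_continuous_on P G"
    using continuous_on_subset[OF contG \<open>P \<subseteq> coeff_dom\<close>] \<open>compact P\<close>
    by (rule compact_uniformly_continuous)
  show ?thesis
    unfolding unif_diff_on_def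
  proof (rule exI[of _ "\<lambda>t z v. E 0 v \<bullet> G (E t z)"], rule conjI)
    show "\<exists>L\<ge>0. \<forall>t\<in>{0..1}. \<forall>z\<in>S. linear (\<lambda>v. E 0 v \<bullet> G (E t z)) \<and>
        (\<forall>v. norm (E 0 v \<bullet> G (E t z)) \<le> L * norm v)"
    proof (intro exI[of _ "max 0 L"] conjI ballI allI)
      fix t z assume "t \<in> {0..1::real}" "z \<in> S"
      show "linear (\<lambda>v. E 0 v \<bullet> G (E t z))"
        by (intro linearI) (auto simp: E_def inner_prod_def algebra_simps inner_left_distrib)
      fix v
      have "norm (E 0 v \<bullet> G (E t z)) \<le> norm (E 0 v) * norm (G (E t z))" 
        unfolding real_norm_def by (rule Cauchy_Schwarz_ineq2)
      also have "\<dots> \<le> norm v * max 0 L"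
        unfolding E_lin using L[OF P] \<open>t \<in> _\<close> \<open>z \<in> S\<close> by (intro mult_left_mono max.coboundedI2) auto
      finally show "norm (E 0 v \<bullet> G (E t z)) \<le> max 0 L * norm v" by (simp add: mult.commute)
    qed simp
    show "\<forall>e>0. \<exists>d>0. \<forall>t\<in>{0..1}. \<forall>z\<in>S. \<forall>w\<in>S. norm (w - z) < d \<longrightarrow>
      norm (F (fst w, t, snd w) - F (fst z, t, snd z) - E 0 (w - z) \<bullet> G (E t z)) \<le> e * norm (w - z)"
    proof (intro allI impI)
      fix e :: real assume "e > 0"
      obtain d where "d > 0" and d: "\<And>p q. p \<in> P \<Longrightarrow> q \<in> P \<Longrightarrow> dist q p < d \<Longrightarrow> dist (G q) (G p) < e"
        using ucG \<open>e > 0\<close> unfolding uniformly_continuous_on_def by blast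
      have pos: "norm (F (E t w) - F (E t z) - E 0 (w - z) \<bullet> G (E t z)) \<le> e * norm (w - z)"
        if t: "t \<in> {0<..1}" and zw: "z \<in> S" "w \<in> S" "norm (w - z) < d" for t z w
      proof -
        have seg: "closed_segment z w \<subseteq> S" using zw S(2) by (simp add: closed_segment_subset)
        have "norm ((F (E t w) - E 0 w \<bullet> G (E t z)) - (F (E t z) - E 0 z \<bullet> G (E t z))) \<le> e * norm (w - z)"
        proof (rule differentiable_bound[where S = "closed_segment z w"])
          fix y assume y: "y \<in> closed_segment z w"
          have dE: "(E s has_derivative E 0) (at y within closed_segment z w)" for s
            unfolding E_def by (auto intro!: derivative_eq_intros)
          have "(F has_derivative (\<lambda>v. v \<bullet> G (E t y))) (at (E t y))"
            using G[OF E_int] t by simp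
          from has_derivative_compose[OF dE this]
          show "((\<lambda>y. F (E t y) - E 0 y \<bullet> G (E t z)) has_derivative
              (\<lambda>v. E 0 v \<bullet> G (E t y) - E 0 v \<bullet> G (E t z))) (at y within closed_segment z w)"
            by (intro has_derivative_diff has_derivative_inner_left dE)
          have "norm (y - z) \<le> norm (w - z)" using y by (rule segment_bound)
          then have "dist (E t y) (E t z) < d"
            using zw E_lin(2)[of "y - z"] by (simp add: E_def dist_norm)
          then have "dist (G (E t y)) (G (E t z)) < e"
            using y seg zw t by (intro d P) auto
          then have ge: "norm (G (E t y) - G (E t z)) \<le> e" by (simp add: dist_norm)
          show "onorm (\<lambda>v. E 0 v \<bullet> G (E t y) - E 0 v \<bullet> G (E t z)) \<le> e"
          proof (rule onorm_bound)
            fix v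
            have "norm (E 0 v \<bullet> (G (E t y) - G (E t z))) \<le> norm (E 0 v) * norm (G (E t y) - G (E t z))"
              unfolding real_norm_def by (rule Cauchy_Schwarz_ineq2)
            also have "\<dots> \<le> norm v * e" unfolding E_lin using ge by (intro mult_left_mono) auto
            finally show "norm (E 0 v \<bullet> G (E t y) - E 0 v \<bullet> G (E t z)) \<le> e * norm v"
              by (simp add: inner_diff_right mult.commute)
          qed (use \<open>e > 0\<close> in simp)
        qed auto
        then show ?thesis by (simp add: E_lin inner_diff_left algebra_simps)
      qed
      have "norm (F (E t w) - F (E t z) - E 0 (w - z) \<bullet> G (E t z)) \<le> e * norm (w - z)"
        if t: "t \<in> {0..1}" and zw: "z \<in> S" "w \<in> S" "norm (w - z) < d" for t z w
      proof (rule continuous_le_on_closure[where S = "{0<..1::real}" and x = t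
            and f = "\<lambda>t. norm (F (E t w) - F (E t z) - E 0 (w - z) \<bullet> G (E t z))"])
        have "continuous_on {0..1} (\<lambda>t. F (E t y))" "continuous_on {0..1} (\<lambda>t. G (E t y))" for y
          using E_dom
          by (auto simp: E_def intro!: continuous_on_compose2[OF contF] continuous_on_compose2[OF contG] continuous_intros)
        then show "continuous_on (closure {0<..1::real}) (\<lambda>t. norm (F (E t w) - F (E t z) - E 0 (w - z) \<bullet> G (E t z)))"
          by (intro continuous_intros) auto
      qed (use t pos zw in auto)
      then show "\<exists>d>0. \<forall>t\<in>{0..1}. \<forall>z\<in>S. \<forall>w\<in>S. norm (w - z) < d \<longrightarrow>
        norm (F (fst w, t, snd w) - F (fst z, t, snd z) - E 0 (w - z) \<bullet> G (E t z)) \<le> e * norm (w - z)"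
        using \<open>d > 0\<close> unfolding E_def by blast
    qed
  qed
qed

text \<open>
  Provides both the smooth truncation of the real line and the extension of the initial data. The
  antiderivative is constant outside \<open>{-R..R}\<close>, hence bounded; it is uniformly differentiable because a
  compactly supported continuous function is uniformly continuous.
\<close>

lemma compactly_supported_antiderivative:
  fixes d :: "real \<Rightarrow> real"
  assumes cont: "continuous_on UNIV d" and R: "R > 0" "\<And>x. \<bar>x\<bar> \<ge> R \<Longrightarrow> d x = 0"
  shows "\<exists>F C. F x0 = y0 \<and> (\<forall>x. (F has_real_derivative d x) (at x)) \<and> (\<forall>x. \<bar>F x\<bar> \<le> C) \<and>
     unif_diff_on UNIV UNIV (\<lambda>_::unit. F) (\<lambda>_ x v. d x * v)"
proof -
  define F where "F = (\<lambda>x::real. y0 + (LBINT y=x0..x. d y))"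
  have F: "(F has_real_derivative d x) (at x)" for x
  proof -
    define l where "l = min x0 x - 1"
    define r where "r = max x0 x + 1"
    have "((\<lambda>u. LBINT y=x0..u. d y) has_vector_derivative d x) (at x within {l..r})"
      by (rule interval_integral_FTC2) (auto simp: l_def r_def intro: continuous_on_subset[OF cont])
    then have "((\<lambda>u. LBINT y=x0..u. d y) has_vector_derivative d x) (at x)"
      using at_within_Icc_at[of l x r] by (simp add: l_def r_def min_def max_def split: if_splits)
    then show ?thesis
      unfolding F_def has_real_derivative_iff_has_vector_derivative
      by (auto intro!: derivative_eq_intros)
  qed
  define p where "p = (\<lambda>x. max (-R) (min R x))"
  have p: "p x \<in> {-R..R}" "\<bar>p x - p y\<bar> \<le> \<bar>x - y\<bar>" "d x = d (p x)" for x y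
    using R by (auto simp: p_def max_def min_def)
  obtain B where "B \<ge> 0" and B: "\<And>x. x \<in> {-R..R} \<Longrightarrow> norm (d x) \<le> B"
    using continuous_on_compact_bound[OF compact_Icc continuous_on_subset[OF cont]] by (metis subset_UNIV)
  have dB: "\<bar>d x\<bar> \<le> B" for x using B[OF p(1)[of x]] p(3)[of x] by simp
  have "continuous_on {-R..R} F"
    using F by (auto intro!: continuous_at_imp_continuous_on DERIV_isCont)
  then obtain C where C: "\<And>x. x \<in> {-R..R} \<Longrightarrow> norm (F x) \<le> C"
    using continuous_on_compact_bound[OF compact_Icc] by metis
  have FC: "\<bar>F x\<bar> \<le> C" for x
  proof -
    have "F x = F (p x)"
    proof (cases "x = p x")
      case False
      then have "norm (F x - F (p x)) \<le> 0 * \<bar>x - p x\<bar>"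
        using F R
        by (intro vector_increment_bound[where S = "closed_segment x (p x)" and f' = d])
          (auto simp: closed_segment_eq_real_ivl p_def max_def min_def
             has_real_derivative_iff_has_vector_derivative has_vector_derivative_at_within split: if_splits)
      then show ?thesis by simp
    qed simp
    then show ?thesis using C[OF p(1)[of x]] by simp
  qed
  have uc: "uniformly_continuous_on {-R..R} d"
    by (intro compact_uniformly_continuous continuous_on_subset[OF cont]) auto
  have "unif_diff_on UNIV UNIV (\<lambda>_::unit. F) (\<lambda>_ x v. d x * v)"
    unfolding unif_diff_on_def
  proof (rule conjI)
    show "\<exists>L\<ge>0. \<forall>t\<in>UNIV::unit set. \<forall>z\<in>UNIV. linear ((*) (d z)) \<and> (\<forall>v. norm (d z * v) \<le> L * norm v)"
      using \<open>B \<ge> 0\<close> dB by (intro exI[of _ B]) (auto simp: abs_mult intro!: linear_times mult_right_mono)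
    show "\<forall>e>0. \<exists>\<delta>>0. \<forall>t\<in>UNIV::unit set. \<forall>z\<in>UNIV. \<forall>w\<in>UNIV. norm (w - z) < \<delta> \<longrightarrow>
        norm (F w - F z - d z * (w - z)) \<le> e * norm (w - z)"
    proof (intro allI impI)
      fix e :: real assume "e > 0"
      obtain \<delta> where "\<delta> > 0"
        and \<delta>: "\<And>x y. x \<in> {-R..R} \<Longrightarrow> y \<in> {-R..R} \<Longrightarrow> dist y x < \<delta> \<Longrightarrow> dist (d y) (d x) < e"
        using uniformly_continuous_onE[OF uc \<open>e > 0\<close>] by metis
      have near: "\<bar>d y - d z\<bar> \<le> e" if "\<bar>y - z\<bar> < \<delta>" for y z
        using \<delta>[OF p(1) p(1), of y z] p(2)[of y z] p(3) that by (simp add: dist_real_def)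
      have "norm (F w - F z - d z * (w - z)) \<le> e * norm (w - z)" if "\<bar>w - z\<bar> < \<delta>" for z w
      proof -
        have "norm ((F w - d z * w) - (F z - d z * z)) \<le> e * \<bar>w - z\<bar>"
        proof (rule vector_increment_bound[where S = "closed_segment z w" and f' = "\<lambda>y. d y - d z"])
          fix y assume y: "y \<in> closed_segment z w"
          have "((\<lambda>w. F w - d z * w) has_real_derivative d y - d z) (at y)"
            using F by (auto intro!: derivative_eq_intros)
          then show "((\<lambda>w. F w - d z * w) has_vector_derivative d y - d z) (at y within closed_segment z w)"
            by (simp add: has_real_derivative_iff_has_vector_derivative has_vector_derivative_at_within)
          show "norm (d y - d z) \<le> e"
            using near[of y z] segment_bound(1)[OF y] that by simp
        qed auto
        then show ?thesis by (simp add: algebra_simps)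
      qed
      then show "\<exists>\<delta>>0. \<forall>t\<in>UNIV::unit set. \<forall>z\<in>UNIV. \<forall>w\<in>UNIV. norm (w - z) < \<delta> \<longrightarrow>
        norm (F w - F z - d z * (w - z)) \<le> e * norm (w - z)"
        using \<open>\<delta> > 0\<close> by auto
    qed
  qed
  moreover have "F x0 = y0" by (simp add: F_def)
  ultimately show ?thesis using F FC by blast
qed

definition tent :: "real \<Rightarrow> real \<Rightarrow> real" where
  "tent R x = max 0 (min 1 (R + 1 - \<bar>x\<bar>))"

lemma tent:
  "continuous_on S (tent R)" "\<bar>x\<bar> \<le> R \<Longrightarrow> tent R x = 1" "\<bar>x\<bar> \<ge> R + 1 \<Longrightarrow> tent R x = 0"
proof -
  show "continuous_on S (tent R)" unfolding tent_def[abs_def] by (intro continuous_intros)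
qed (auto simp: tent_def)

lemma smooth_clamp:
  assumes "(R::real) > 0"
  shows "\<exists>\<phi> \<phi>' C. (\<forall>x. \<bar>x\<bar> \<le> R \<longrightarrow> \<phi> x = x) \<and> (\<forall>x. \<bar>\<phi> x\<bar> \<le> C) \<and>
     unif_diff_on UNIV UNIV (\<lambda>_::unit. \<phi>) (\<lambda>_ x v. \<phi>' x * v :: real)"
proof -
  obtain F C where F: "F 0 = 0" "\<And>x. (F has_real_derivative tent R x) (at x)" "\<And>x. \<bar>F x\<bar> \<le> C"
    "unif_diff_on UNIV UNIV (\<lambda>_::unit. F) (\<lambda>_ x v. tent R x * v)"
    using compactly_supported_antiderivative[of "tent R" "R + 1" 0 0, OF tent(1) _ tent(3)] assms by auto
  have "F x = x" if "\<bar>x\<bar> \<le> R" for x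
  proof -
    have "norm ((F x - x) - (F 0 - 0)) \<le> 0 * \<bar>x - 0\<bar>"
    proof (rule vector_increment_bound[where S = "{-R..R}" and f' = "\<lambda>y. tent R y - 1"])
      show "((\<lambda>x. F x - x) has_vector_derivative tent R y - 1) (at y within {-R..R})" for y
        using F(2)[of y] unfolding has_real_derivative_iff_has_vector_derivative
        by (intro has_vector_derivative_at_within[OF has_vector_derivative_diff] has_vector_derivative_id)
    qed (use that assms in \<open>auto simp: tent\<close>)
    then show ?thesis using F(1) by simp
  qed
  then show ?thesis using F(3,4) by blast
qed

text \<open>
  The truncation is applied to each coordinate, so its values lie in a box. A box is convex, and this
  is what uniform differentiability of the truncated coefficients requires.
\<close>

lemma smooth_box_clamp:
  assumes "R > 0"
  shows "\<exists>k k' C. (\<forall>z::'a::euclidean_space. norm z \<le> R \<longrightarrow> k z = z) \<and>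
     (\<forall>z. k z \<in> cbox (- C *\<^sub>R One) (C *\<^sub>R One)) \<and> unif_diff_on UNIV UNIV (\<lambda>_::unit. k) (\<lambda>_::unit. k')"
proof -
  obtain \<phi> \<phi>' C where \<phi>: "\<And>x. \<bar>x\<bar> \<le> R \<Longrightarrow> \<phi> x = x" "\<And>x. \<bar>\<phi> x\<bar> \<le> C"
    "unif_diff_on UNIV UNIV (\<lambda>_::unit. \<phi>) (\<lambda>_ x v. \<phi>' x * v)"
    using smooth_clamp[OF assms] by blast
  define k where "k = (\<lambda>z::'a. \<Sum>b\<in>Basis. \<phi> (z \<bullet> b) *\<^sub>R b)"
  define k' where "k' = (\<lambda>z v::'a. \<Sum>b\<in>Basis. (\<phi>' (z \<bullet> b) * (v \<bullet> b)) *\<^sub>R b)"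
  obtain L where "L \<ge> 0" and L: "\<And>x v. \<bar>\<phi>' x * v\<bar> \<le> L * \<bar>v\<bar>"
    using \<phi>(3) unfolding unif_diff_on_def by auto
  \<comment> \<open>a bound on every component with constant \<open>c\<close> costs a factor \<open>DIM('a)\<close> in norm\<close>
  have sum_le: "norm (\<Sum>b\<in>Basis. h b *\<^sub>R b) \<le> DIM('a) * (c * norm (v::'a))"
    if "\<And>b. b \<in> Basis \<Longrightarrow> \<bar>h b\<bar> \<le> c * \<bar>v \<bullet> b\<bar>" "c \<ge> 0" for h c v
  proof -
    have "norm (\<Sum>b\<in>Basis. h b *\<^sub>R b) \<le> (\<Sum>b\<in>(Basis::'a set). \<bar>h b\<bar>)"
      by (rule order_trans[OF norm_sum]) simp
    also have "\<dots> \<le> of_nat DIM('a) * (c * norm v)"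
    proof (rule sum_bounded_above)
      fix b :: 'a assume "b \<in> Basis"
      then show "\<bar>h b\<bar> \<le> c * norm v"
        using that(1)[of b] Basis_le_norm[of b v] mult_left_mono[OF _ \<open>c \<ge> 0\<close>] order_trans by blast
    qed
    finally show ?thesis by simp
  qed
  have "unif_diff_on UNIV UNIV (\<lambda>_::unit. k) (\<lambda>_::unit. k')"
    unfolding unif_diff_on_def
  proof (rule conjI)
    show "\<exists>L\<ge>0. \<forall>t\<in>UNIV::unit set. \<forall>z\<in>UNIV. linear (k' z) \<and> (\<forall>v. norm (k' z v) \<le> L * norm v)"
    proof (intro exI[of _ "DIM('a) * L"] conjI ballI allI)
      show "linear (k' z)" for z
        unfolding k'_def
        by (intro linearI) (auto simp: inner_left_distrib algebra_simps sum.distrib scaleR_sum_right)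
      show "norm (k' z v) \<le> DIM('a) * L * norm v" for z v
        unfolding k'_def using sum_le[OF L \<open>L \<ge> 0\<close>] by (simp add: mult.assoc)
    qed (use \<open>L \<ge> 0\<close> in simp)
    show "\<forall>e>0. \<exists>d>0. \<forall>t\<in>UNIV::unit set. \<forall>z\<in>UNIV. \<forall>w\<in>UNIV. norm (w - z) < d \<longrightarrow>
        norm (k w - k z - k' z (w - z)) \<le> e * norm (w - z)"
    proof (intro allI impI)
      fix e :: real assume "e > 0"
      define e' where "e' = e / DIM('a)"
      have "e' > 0" using \<open>e > 0\<close> by (simp add: e'_def)
      then obtain d where "d > 0"
        and d: "\<And>x y. \<bar>y - x\<bar> < d \<Longrightarrow> \<bar>\<phi> y - \<phi> x - \<phi>' x * (y - x)\<bar> \<le> e' * \<bar>y - x\<bar>"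
        using \<phi>(3) unfolding unif_diff_on_def by (auto; metis)
      have "norm (k w - k z - k' z (w - z)) \<le> e * norm (w - z)" if "norm (w - z) < d" for z w
      proof -
        have "k w - k z - k' z (w - z) =
            (\<Sum>b\<in>Basis. (\<phi> (w \<bullet> b) - \<phi> (z \<bullet> b) - \<phi>' (z \<bullet> b) * ((w - z) \<bullet> b)) *\<^sub>R b)"
          by (simp add: k_def k'_def scaleR_diff_left sum_subtractf)
        also have "norm \<dots> \<le> DIM('a) * (e' * norm (w - z))"
        proof (rule sum_le)
          fix b :: 'a assume "b \<in> Basis"
          then have "\<bar>w \<bullet> b - z \<bullet> b\<bar> < d"
            using Basis_le_norm[of b "w - z"] that by (simp add: inner_diff_left)
          from d[OF this] show "\<bar>\<phi> (w \<bullet> b) - \<phi> (z \<bullet> b) - \<phi>' (z \<bullet> b) * ((w - z) \<bullet> b)\<bar> \<le> e' * \<bar>(w - z) \<bullet> b\<bar>"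
            by (simp add: inner_diff_left)
        qed (use \<open>e' > 0\<close> in simp)
        finally show ?thesis by (simp add: e'_def)
      qed
      then show "\<exists>d>0. \<forall>t\<in>UNIV::unit set. \<forall>z\<in>UNIV. \<forall>w\<in>UNIV. norm (w - z) < d \<longrightarrow>
        norm (k w - k z - k' z (w - z)) \<le> e * norm (w - z)" using \<open>d > 0\<close> by blast
    qed
  qed
  moreover have "k z = z" if "norm z \<le> R" for z
  proof -
    have "k z = (\<Sum>b\<in>Basis. (z \<bullet> b) *\<^sub>R b)"
      unfolding k_def using that by (intro sum.cong) (auto intro!: \<phi>(1) order_trans[OF Basis_le_norm])
    then show ?thesis by (simp add: euclidean_representation)
  qed
  moreover have "k z \<in> cbox (- C *\<^sub>R One) (C *\<^sub>R One)" for z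
    using \<phi>(2) by (auto simp: k_def mem_box abs_le_iff minus_le_iff)
  ultimately show ?thesis by blast
qed

lemma global_coefficient:
  fixes F :: "real \<times> real \<times> (real^'n) \<Rightarrow> real"
  assumes F: "C1_on coeff_dom F" and "R > 0"
  shows "\<exists>f f' C. unif_diff_on {0..1} UNIV f f' \<and> continuous_on ({0..1} \<times> UNIV) (\<lambda>(t, z). f t z) \<and>
     (\<forall>t\<in>{0..1}. \<forall>z. \<bar>f t z\<bar> \<le> C) \<and>
     (\<forall>t\<in>{0..1}. \<forall>z. norm z \<le> R \<longrightarrow> f t z = F (fst z, t, snd z))"
proof -
  obtain k k' C where "(\<forall>z. norm z \<le> R \<longrightarrow> k z = z) \<and>
     (\<forall>z. k z \<in> cbox (- C *\<^sub>R One) (C *\<^sub>R (One :: real \<times> (real^'n)))) \<and>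
     unif_diff_on UNIV UNIV (\<lambda>_::unit. k) (\<lambda>_::unit. k')"
    using smooth_box_clamp[OF \<open>R > 0\<close>] by (elim exE) (rule that)
  then have k: "\<And>z. norm z \<le> R \<Longrightarrow> k z = z"
    "\<And>z. k z \<in> cbox (- C *\<^sub>R One) (C *\<^sub>R (One :: real \<times> (real^'n)))"
    "unif_diff_on UNIV UNIV (\<lambda>_::unit. k) (\<lambda>_::unit. k')"
    by blast+
  define S where "S = cbox (- C *\<^sub>R One) (C *\<^sub>R (One :: real \<times> (real^'n)))"
  define f where "f = (\<lambda>t z. F (fst (k z), t, snd (k z)))"
  obtain F' where "unif_diff_on {0..1} S (\<lambda>t z. F (fst z, t, snd z)) F'"
    using coefficient_unif_diff_on_compact[OF F, of S] by (auto simp: S_def)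
  from unif_diff_on_compose[OF this k(3)]
  have ud: "unif_diff_on {0..1} UNIV f (\<lambda>t z v. F' t (k z) (k' z v))"
    using k(2) by (simp add: S_def f_def)
  have contF: "continuous_on coeff_dom F" using F by (simp add: C1_on_def)
  have contk: "continuous_on UNIV k"
    by (rule has_derivative_continuous_on) (rule unif_diff_on_has_derivative[OF k(3)], auto)
  have "continuous_on ({0..1} \<times> S) (\<lambda>(t, z). F (fst z, t, snd z))"
    by (auto intro!: continuous_on_compose2[OF contF] continuous_intros simp: case_prod_beta coeff_dom_def)
  note cs = this
  have "compact ({0..1::real} \<times> S)" by (auto simp: S_def intro: compact_Times)
  then obtain B where "B \<ge> 0"
    and "\<And>p. p \<in> {0..1} \<times> S \<Longrightarrow> norm (case p of (t, z) \<Rightarrow> F (fst z, t, snd z)) \<le> B"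
    by (rule continuous_on_compact_bound[OF _ cs]) (rule that)
  from this(2)[of "(t, z)" for t z]
  have B: "\<And>t z. t \<in> {0..1} \<Longrightarrow> z \<in> S \<Longrightarrow> \<bar>F (fst z, t, snd z)\<bar> \<le> B" by simp
  have "continuous_on ({0..1} \<times> UNIV) (\<lambda>p. (\<lambda>(t, z). F (fst z, t, snd z)) (fst p, k (snd p)))"
    by (rule continuous_on_compose2[OF cs])
      (use k(2) in \<open>auto intro!: continuous_intros continuous_on_compose2[OF contk] simp: S_def\<close>)
  then have "continuous_on ({0..1} \<times> UNIV) (\<lambda>(t, z). f t z)"
    by (simp add: f_def case_prod_beta)
  moreover have "\<bar>f t z\<bar> \<le> B" if "t \<in> {0..1}" for t z
    using B[OF that, of "k z"] k(2) by (simp add: f_def S_def)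
  moreover have "f t z = F (fst z, t, snd z)" if "norm z \<le> R" for t z
    using k(1)[OF that] by (simp add: f_def)
  ultimately show ?thesis using ud by blast
qed

text \<open>
  The derivative is extended by its boundary values and cut off by \<open>tent\<close>, and then integrated from
  \<open>a\<close>. Extending the derivative, not the function, makes the result \<open>C\<^sup>1\<close> at \<open>a\<close> and \<open>b\<close>.
\<close>

lemma extend_initial_data:
  fixes f :: "real \<Rightarrow> real"
  assumes "C1_on {a..b} f" "a < b"
  shows "\<exists>F d C. (\<forall>x\<in>{a..b}. F x = f x) \<and> (\<forall>x. \<bar>F x\<bar> \<le> C) \<and>
     unif_diff_on UNIV UNIV (\<lambda>_::unit. F) (\<lambda>_ x v. d x * v)"
proof -
  obtain g where "has_partial_on {a..b} f 1 g"
    using assms(1) unfolding C1_on_def by (metis Basis_real_def insertI1)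
  then have g: "continuous_on {a..b} g"
    "\<And>x. x \<in> {a<..<b} \<Longrightarrow> ((\<lambda>s. f (x + s)) has_vector_derivative g x) (at 0)"
    unfolding has_partial_on_def by simp_all
  define p where "p = (\<lambda>x. max a (min b x))"
  define R where "R = max \<bar>a\<bar> \<bar>b\<bar>"
  define d where "d = (\<lambda>x. g (p x) * tent R x)"
  have "continuous_on UNIV d"
    unfolding d_def using assms(2)
    by (intro continuous_intros tent continuous_on_compose2[OF g(1)]) (auto simp: p_def intro!: continuous_intros)
  moreover have "R + 1 > 0" "\<And>x. \<bar>x\<bar> \<ge> R + 1 \<Longrightarrow> d x = 0" by (auto simp: d_def R_def tent)
  ultimately obtain F C where F: "F a = f a" "\<And>x. (F has_real_derivative d x) (at x)" "\<And>x. \<bar>F x\<bar> \<le> C"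
    "unif_diff_on UNIV UNIV (\<lambda>_::unit. F) (\<lambda>_ x v. d x * v)"
    using compactly_supported_antiderivative[of d "R + 1" a "f a"] by blast
  have "F x = f x" if "x \<in> {a..b}" for x
  proof (cases "x = a")
    case False
    have "F x - f x = F a - f a"
    proof (rule DERIV_isconst_end[where f = "\<lambda>x. F x - f x"])
      show "a < x" using False that by simp
      have "continuous_on {a..b} f" using assms(1) by (simp add: C1_on_def)
      then show "continuous_on {a..x} (\<lambda>x. F x - f x)"
        using that continuous_on_subset[of "{a..b}" f "{a..x}"]
        by (intro continuous_intros DERIV_continuous_on[OF has_field_derivative_at_within[OF F(2)]]) auto
      fix y assume y: "a < y" "y < x"
      have "((\<lambda>s. f (s + y)) has_real_derivative g y) (at 0)"
        using g(2)[of y] y that by (simp add: has_real_derivative_iff_has_vector_derivative add.commute)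
      then have "(f has_real_derivative g y) (at y)" using DERIV_shift[of f "g y" 0 y] by simp
      moreover have "d y = g y" using y that by (auto simp: d_def p_def R_def tent min_def max_def)
      ultimately show "((\<lambda>x. F x - f x) has_real_derivative 0) (at y)"
        using DERIV_diff[OF F(2)[of y], of f "g y"] by simp
    qed
    then show ?thesis using F(1) by simp
  qed (use F in simp)
  then show ?thesis using F(3,4) by blast
qed

section \<open>Scalar differential equations on a short time interval\<close>

text \<open>
  A Gronwall estimate for short times, with the factor 2 in place of an exponential: at the point where
  \<open>\<bar>y - z\<bar>\<close> is maximal, at most half of the maximum comes from the term with \<open>K\<close>. It gives uniqueness
  of solutions and their dependence on initial values and right-hand side all at once.
\<close>

lemma curve_compare:
  fixes y z :: "real \<Rightarrow> real"
  assumes y: "\<And>s. s \<in> {0..T} \<Longrightarrow> (y has_real_derivative y' s) (at s within {0..T})"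
    and z: "\<And>s. s \<in> {0..T} \<Longrightarrow> (z has_real_derivative z' s) (at s within {0..T})"
    and d: "\<And>s. s \<in> {0..T} \<Longrightarrow> \<bar>y' s - z' s\<bar> \<le> K * \<bar>y s - z s\<bar> + \<eta>"
    and K: "K \<ge> 0" "\<eta> \<ge> 0" "K * T \<le> 1/2" and t: "t \<in> {0..T}" and s: "s \<in> {0..T}"
  shows "\<bar>y s - z s\<bar> \<le> 2 * (\<bar>y t - z t\<bar> + T * \<eta>)"
proof -
  have "continuous_on {0..T} y" "continuous_on {0..T} z"
    using y z by (blast intro: DERIV_continuous_on)+
  then have "continuous_on {0..T} (\<lambda>s. \<bar>y s - z s\<bar>)" by (intro continuous_intros)
  then obtain r where r: "r \<in> {0..T}" and max: "\<And>s. s \<in> {0..T} \<Longrightarrow> \<bar>y s - z s\<bar> \<le> \<bar>y r - z r\<bar>"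
    using continuous_attains_sup[of "{0..T}" "\<lambda>s. \<bar>y s - z s\<bar>"] t by auto
  define m where "m = \<bar>y r - z r\<bar>"
  have "norm ((y r - z r) - (y t - z t)) \<le> (K * m + \<eta>) * \<bar>r - t\<bar>"
  proof (rule vector_increment_bound[where S = "{0..T}" and f' = "\<lambda>s. y' s - z' s"])
    fix s assume s: "s \<in> {0..T}"
    show "((\<lambda>s. y s - z s) has_vector_derivative y' s - z' s) (at s within {0..T})"
      using DERIV_diff[OF y z, OF s s] by (simp add: has_real_derivative_iff_has_vector_derivative)
    show "norm (y' s - z' s) \<le> K * m + \<eta>"
      using d[OF s] mult_left_mono[OF max[OF s] K(1)] by (simp add: m_def)
  qed (use r t in auto)
  also have "\<dots> \<le> (K * m + \<eta>) * T"
    using r t K by (intro mult_left_mono) (auto simp: m_def)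
  also have "\<dots> = (K * T) * m + T * \<eta>" by (simp add: algebra_simps)
  also have "\<dots> \<le> (1/2) * m + T * \<eta>" using K by (intro add_right_mono mult_right_mono) (auto simp: m_def)
  finally have "\<bar>(y r - z r) - (y t - z t)\<bar> \<le> m / 2 + T * \<eta>" by simp
  moreover have "m \<le> \<bar>(y r - z r) - (y t - z t)\<bar> + \<bar>y t - z t\<bar>" unfolding m_def by linarith
  ultimately have "m \<le> 2 * (\<bar>y t - z t\<bar> + T * \<eta>)" by simp
  then show ?thesis using max[OF s] by (simp add: m_def)
qed

text \<open>
  Picard iteration converges on the whole of \<open>{0..T}\<close> because \<open>K * T \<le> 1/2\<close>. It runs in the space of
  bounded continuous functions on all of \<open>\<real>\<close>, whence the clamping of the time to \<open>{0..T}\<close>.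
\<close>

lemma picard_lindelof:
  fixes c :: "real \<Rightarrow> real \<Rightarrow> real"
  assumes T: "T > 0" and cont: "continuous_on ({0..T} \<times> UNIV) (\<lambda>(s, x). c s x)"
    and lip: "\<And>s x y. s \<in> {0..T} \<Longrightarrow> \<bar>c s x - c s y\<bar> \<le> K * \<bar>x - y\<bar>"
    and bound: "\<And>s x. s \<in> {0..T} \<Longrightarrow> \<bar>c s x\<bar> \<le> B"
    and K: "K \<ge> 0" "K * T \<le> 1/2" and t: "t \<in> {0..T}"
  shows "\<exists>y. y t = x \<and> (\<forall>s\<in>{0..T}. (y has_real_derivative c s (y s)) (at s within {0..T}))"
proof -
  define p where "p = (\<lambda>s. max 0 (min T s))"
  have p: "p s \<in> {0..T}" "s \<in> {0..T} \<Longrightarrow> p s = s" for s using T by (auto simp: p_def)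
  have contp: "continuous_on S p" for S unfolding p_def by (intro continuous_intros)
  define W where "W = (\<lambda>y s. c s (apply_bcontfun y s))"
  define G where "G = (\<lambda>y (s::real). x + (LBINT r=t..s. W y r))"
  have contW: "continuous_on {0..T} (W y)" for y
  proof -
    have "continuous_on {0..T} (\<lambda>s. (\<lambda>(s, x). c s x) (s, apply_bcontfun y s))"
      by (rule continuous_on_compose2[OF cont]) (auto intro!: continuous_intros)
    then show ?thesis by (simp add: W_def)
  qed
  have G: "(G y has_vector_derivative W y s) (at s within {0..T})" if "s \<in> {0..T}" for y s
    using interval_integral_FTC2[of 0 t T "W y" s] t that contW
    by (simp add: G_def has_vector_derivative_add_const add.commute[of x])
  have Gt: "G y t = x" for y by (simp add: G_def)
  have contG: "continuous_on {0..T} (G y)" for y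
    using G by (rule continuous_on_vector_derivative)
  have bnd: "\<bar>G y s - x\<bar> \<le> B * T" if "s \<in> {0..T}" for y s
  proof -
    have "norm (G y s - G y t) \<le> B * \<bar>s - t\<bar>"
      by (rule vector_increment_bound[OF G]) (use that t bound in \<open>auto simp: W_def\<close>)
    also have "\<dots> \<le> B * T" using that t bound[OF t, of 0] by (intro mult_left_mono) auto
    finally show ?thesis by (simp add: Gt)
  qed
  have bc: "(\<lambda>s. G y (p s)) \<in> bcontfun" for y
  proof -
    have "continuous_on UNIV (\<lambda>s. G y (p s))"
      by (rule continuous_on_compose2[OF contG contp]) (use p in auto)
    moreover have "\<bar>G y (p s)\<bar> \<le> \<bar>x\<bar> + B * T" for s using bnd[OF p(1), of y s] by linarith
    ultimately show ?thesis by (auto simp: bcontfun_def bounded_iff)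
  qed
  define \<Phi> where "\<Phi> = (\<lambda>y. Bcontfun (\<lambda>s. G y (p s)))"
  have \<Phi>: "apply_bcontfun (\<Phi> y) s = G y (p s)" for y s
    using bc by (simp add: \<Phi>_def Bcontfun_inverse)
  have "dist (\<Phi> y) (\<Phi> z) \<le> (1/2) * dist y z" for y z
  proof (rule dist_bound)
    fix s
    have "norm ((G y (p s) - G z (p s)) - (G y t - G z t)) \<le> (K * dist y z) * \<bar>p s - t\<bar>"
    proof (rule vector_increment_bound[where S = "{0..T}" and f' = "\<lambda>s. W y s - W z s"])
      fix r assume r: "r \<in> {0..T}"
      show "((\<lambda>s. G y s - G z s) has_vector_derivative W y r - W z r) (at r within {0..T})"
        using G[OF r] by (intro has_vector_derivative_diff) auto
      have "\<bar>W y r - W z r\<bar> \<le> K * \<bar>apply_bcontfun y r - apply_bcontfun z r\<bar>"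
        using lip[OF r] by (simp add: W_def)
      also have "\<dots> \<le> K * dist y z"
        using K dist_bounded[of y r z] by (intro mult_left_mono) (auto simp: dist_real_def)
      finally show "norm (W y r - W z r) \<le> K * dist y z" by simp
    qed (use p t in auto)
    also have "\<dots> \<le> (K * dist y z) * T"
      using p(1)[of s] t K by (intro mult_left_mono) auto
    also have "\<dots> = (K * T) * dist y z" by simp
    also have "\<dots> \<le> (1/2) * dist y z" using K by (intro mult_right_mono) auto
    finally show "dist (apply_bcontfun (\<Phi> y) s) (apply_bcontfun (\<Phi> z) s) \<le> (1/2) * dist y z"
      by (simp add: \<Phi> Gt dist_real_def)
  qed
  then obtain y where y: "\<Phi> y = y"
    using banach_fix_type[of "1/2" \<Phi>] by auto
  then have yG: "apply_bcontfun y s = G y s" if "s \<in> {0..T}" for s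
    using \<Phi>[of y s] p(2)[OF that] by simp
  show ?thesis
  proof (intro exI[of _ "apply_bcontfun y"] conjI ballI)
    show "apply_bcontfun y t = x" using yG[OF t] Gt by simp
    fix s assume s: "s \<in> {0..T}"
    have "(apply_bcontfun y has_vector_derivative W y s) (at s within {0..T})"
      by (rule has_vector_derivative_transform[OF s _ G[OF s]]) (rule yG)
    then show "(apply_bcontfun y has_real_derivative c s (apply_bcontfun y s)) (at s within {0..T})"
      by (simp add: has_real_derivative_iff_has_vector_derivative W_def)
  qed
qed

section \<open>The transport equations along characteristics\<close>

lemma norm_vec_le:
  fixes x :: "real^'n" and c :: real
  assumes "\<And>i. \<bar>x $ i\<bar> \<le> c"
  shows "norm x \<le> CARD('n) * c"
  using order_trans[OF norm_le_l1_cart sum_bounded_above[of UNIV "\<lambda>i. \<bar>x $ i\<bar>" c]] assms by simp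

text \<open>
  The system \<open>u\<^sub>i\<^sub>t + l\<^sub>i u\<^sub>i\<^sub>x = g\<^sub>i\<close> with \<open>u\<^sub>i(x, 0) = f\<^sub>i x\<close> on \<open>\<real> \<times> {0..T}\<close>, with coefficients that depend on the
  time \<open>t\<close> and the state \<open>z = (x, u)\<close>. The constant \<open>M\<close> will bound the Lipschitz constant of the
  solution in \<open>x\<close>: transport along characteristics multiplies the constant \<open>L\<close> of the data by about
  \<open>2\<close>, and passing from components to the norm costs the factor \<open>CARD('n)\<close>. Then \<open>L * (1 + M)\<close> is a
  Lipschitz constant of the coefficients along such a function, and the time is short in terms of it.
\<close>

locale diagonal_system =
  fixes l g :: "'n::finite \<Rightarrow> real \<Rightarrow> real \<times> (real^'n) \<Rightarrow> real"
    and f :: "'n \<Rightarrow> real \<Rightarrow> real" and B L T M :: real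
  assumes T: "0 < T" "T \<le> 1" and L: "L \<ge> 0"
    and M: "M = CARD('n) * (2 * L + 1)"
    and small: "CARD('n) * (L * (1 + M)) * T \<le> 1/8"
    and cont_l: "\<And>i. continuous_on ({0..T} \<times> UNIV) (\<lambda>(t, z). l i t z)"
    and cont_g: "\<And>i. continuous_on ({0..T} \<times> UNIV) (\<lambda>(t, z). g i t z)"
    and bound_l: "\<And>i t z. t \<in> {0..T} \<Longrightarrow> \<bar>l i t z\<bar> \<le> B"
    and bound_g: "\<And>i t z. t \<in> {0..T} \<Longrightarrow> \<bar>g i t z\<bar> \<le> B"
    and bound_f: "\<And>i x. \<bar>f i x\<bar> \<le> B"
    and lip_l: "\<And>i t z w. t \<in> {0..T} \<Longrightarrow> \<bar>l i t z - l i t w\<bar> \<le> L * norm (z - w)"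
    and lip_g: "\<And>i t z w. t \<in> {0..T} \<Longrightarrow> \<bar>g i t z - g i t w\<bar> \<le> L * norm (z - w)"
    and lip_f: "\<And>i x y. \<bar>f i x - f i y\<bar> \<le> L * \<bar>x - y\<bar>"
begin

definition profile :: "(real \<times> real \<Rightarrow> real^'n) \<Rightarrow> bool" where
  "profile u \<longleftrightarrow> continuous_on UNIV u \<and> (\<forall>x y t. norm (u (x, t) - u (y, t)) \<le> M * \<bar>x - y\<bar>)"

definition is_char :: "(real \<times> real \<Rightarrow> real^'n) \<Rightarrow> 'n \<Rightarrow> (real \<Rightarrow> real) \<Rightarrow> bool" where
  "is_char u i y \<longleftrightarrow>
     (\<forall>s\<in>{0..T}. (y has_real_derivative l i s (y s, u (y s, s))) (at s within {0..T}))"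

definition source :: "(real \<times> real \<Rightarrow> real^'n) \<Rightarrow> 'n \<Rightarrow> (real \<Rightarrow> real) \<Rightarrow> real \<Rightarrow> real" where
  "source u i y t = (LBINT s=0..t. g i s (y s, u (y s, s)))"

lemma B_nonneg: "B \<ge> 0"
  using bound_f abs_ge_zero order_trans by blast

lemma M_ge: "M \<ge> 1" "M \<ge> 0"
proof -
  have "1 * 1 \<le> CARD('n) * (2 * L + 1)"
    using L by (intro mult_mono) auto
  then show "M \<ge> 1" "M \<ge> 0" using M by simp_all
qed

abbreviation (input) K where "K \<equiv> L * (1 + M)"

lemma K: "K \<ge> 0" "K * T \<le> 1/8" "K * T \<le> 1/2" "CARD('n) * (K * T) \<le> 1/8"
proof -
  show "K \<ge> 0" using L M_ge by simp
  then have "1 * (K * T) \<le> CARD('n) * (K * T)" using T by (intro mult_right_mono) auto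
  then show "K * T \<le> 1/8" "K * T \<le> 1/2" "CARD('n) * (K * T) \<le> 1/8" using small by (simp_all add: mult.assoc)
qed

lemma profile_state_diff:
  assumes "profile u" "\<And>p. norm (u p - v p) \<le> \<delta>"
  shows "norm ((x, u (x, s)) - (y, v (y, s))) \<le> (1 + M) * \<bar>x - y\<bar> + \<delta>"
proof -
  have "norm ((x, u (x, s)) - (y, v (y, s))) \<le> norm (x - y) + norm (u (x, s) - v (y, s))"
    using norm_Pair_le[of "x - y" "u (x, s) - v (y, s)"] by simp
  also have "\<dots> \<le> norm (x - y) + (norm (u (x, s) - u (y, s)) + norm (u (y, s) - v (y, s)))"
    using norm_triangle_ineq[of "u (x, s) - u (y, s)" "u (y, s) - v (y, s)"] by simp
  also have "\<dots> \<le> \<bar>x - y\<bar> + (M * \<bar>x - y\<bar> + \<delta>)"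
    using assms by (intro add_mono) (auto simp: profile_def)
  finally show ?thesis by (simp add: distrib_right)
qed

lemma lip_along:
  assumes "profile u" "\<And>p. norm (u p - v p) \<le> \<delta>" "s \<in> {0..T}"
  shows "\<bar>l i s (x, u (x, s)) - l i s (y, v (y, s))\<bar> \<le> K * \<bar>x - y\<bar> + L * \<delta>"
    and "\<bar>g i s (x, u (x, s)) - g i s (y, v (y, s))\<bar> \<le> K * \<bar>x - y\<bar> + L * \<delta>"
proof -
  have "L * norm ((x, u (x, s)) - (y, v (y, s))) \<le> L * ((1 + M) * \<bar>x - y\<bar> + \<delta>)"
    using profile_state_diff[OF assms(1,2)] L by (intro mult_left_mono)
  then have *: "L * norm ((x, u (x, s)) - (y, v (y, s))) \<le> K * \<bar>x - y\<bar> + L * \<delta>"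
    by (simp add: algebra_simps)
  show "\<bar>l i s (x, u (x, s)) - l i s (y, v (y, s))\<bar> \<le> K * \<bar>x - y\<bar> + L * \<delta>"
    using lip_l[OF assms(3)] * by (rule order_trans)
  show "\<bar>g i s (x, u (x, s)) - g i s (y, v (y, s))\<bar> \<le> K * \<bar>x - y\<bar> + L * \<delta>"
    using lip_g[OF assms(3)] * by (rule order_trans)
qed

lemma char_compare:
  assumes "profile u" "\<And>p. norm (u p - v p) \<le> \<delta>" "is_char u i y" "is_char v i z"
    and "t \<in> {0..T}" "s \<in> {0..T}"
  shows "\<bar>y s - z s\<bar> \<le> 2 * (\<bar>y t - z t\<bar> + T * (L * \<delta>))"
proof (rule curve_compare[where K = K])
  show "L * \<delta> \<ge> 0" using assms(2) norm_ge_zero order_trans L by (metis mult_nonneg_nonneg)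
qed (use assms lip_along[OF assms(1,2)] K in \<open>auto simp: is_char_def\<close>)

text \<open>
  Along a Lipschitz profile the speed is a Lipschitz function of the position.
\<close>

lemma ex_char:
  assumes "profile u" "t \<in> {0..T}"
  shows "\<exists>y. y t = x \<and> is_char u i y"
  unfolding is_char_def
proof (rule picard_lindelof)
  have "continuous_on ({0..T} \<times> UNIV) (\<lambda>p. u (snd p, fst p))"
    using assms(1) unfolding profile_def
    by (elim conjE, intro continuous_on_compose2[of UNIV u _ "\<lambda>p. (snd p, fst p)"] continuous_intros) auto
  then have "continuous_on ({0..T} \<times> UNIV) (\<lambda>p. (\<lambda>(t, z). l i t z) (fst p, (snd p, u (snd p, fst p))))"
    by (intro continuous_on_compose2[OF cont_l]) (auto intro!: continuous_intros)
  then show "continuous_on ({0..T} \<times> UNIV) (\<lambda>(s, x). l i s (x, u (x, s)))" by (simp add: case_prod_beta)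
  show "\<bar>l i s (x, u (x, s)) - l i s (y, u (y, s))\<bar> \<le> K * \<bar>x - y\<bar>" if "s \<in> {0..T}" for s x y
    using lip_along(1)[OF assms(1), of u 0] that by simp
qed (use assms T K bound_l in auto)

definition char where "char u i t x = (SOME y. y t = x \<and> is_char u i y)"

lemma char:
  assumes "profile u" "t \<in> {0..T}"
  shows "char u i t x t = x" "is_char u i (char u i t x)"
  using someI_ex[OF ex_char[OF assms]] unfolding char_def by auto

lemma is_char_speed:
  assumes "is_char u i y" "s \<in> {0..T}" "t \<in> {0..T}"
  shows "\<bar>y s - y t\<bar> \<le> B * \<bar>s - t\<bar>"
proof -
  have "norm (y s - y t) \<le> B * \<bar>s - t\<bar>"
    using assms bound_l unfolding is_char_def has_real_derivative_iff_has_vector_derivative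
    by (intro vector_increment_bound[where S = "{0..T}"]) auto
  then show ?thesis by simp
qed

lemma is_char_continuous: "is_char u i y \<Longrightarrow> continuous_on {0..T} y"
  unfolding is_char_def by (auto intro: DERIV_continuous_on)

lemma continuous_along:
  assumes "profile u" "continuous_on {0..T} y"
  shows "continuous_on {0..T} (\<lambda>s. u (y s, s))"
    and "continuous_on {0..T} (\<lambda>s. g i s (y s, u (y s, s)))"
proof -
  show u: "continuous_on {0..T} (\<lambda>s. u (y s, s))"
    using assms unfolding profile_def by (auto intro!: continuous_on_compose2[of UNIV u] continuous_intros)
  show "continuous_on {0..T} (\<lambda>s. g i s (y s, u (y s, s)))"
  proof -
    have "continuous_on {0..T} (\<lambda>s. (\<lambda>(t, z). g i t z) (s, (y s, u (y s, s))))"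
      by (rule continuous_on_compose2[OF cont_g]) (auto intro!: continuous_intros u assms(2))
    then show ?thesis by simp
  qed
qed

lemma source_derivative:
  assumes "profile u" "is_char u i y" "s \<in> {0..T}"
  shows "(source u i y has_vector_derivative g i s (y s, u (y s, s))) (at s within {0..T})"
  unfolding source_def zero_ereal_def
  using assms T by (intro interval_integral_FTC2 continuous_along is_char_continuous) auto

lemma source_0: "source u i y 0 = 0"
  by (simp add: source_def zero_ereal_def)

text \<open>
  The single estimate behind the fixed point argument. With \<open>u = v\<close> it gives the Lipschitz bound
  \<open>M\<close> and the continuity in time of transported functions; with equal end points it gives the
  contraction; with \<open>\<delta> = 0\<close> and equal end points it shows that the transported value does not
  depend on the choice of the characteristic.
\<close>

lemma transport_compare:
  assumes u: "profile u" and v: "profile v" and \<delta>: "\<And>p. norm (u p - v p) \<le> \<delta>"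
    and y: "is_char u i y" and z: "is_char v i z" and t: "t \<in> {0..T}" "t' \<in> {0..T}"
  shows "\<bar>(f i (y 0) + source u i y t) - (f i (z 0) + source v i z t')\<bar>
    \<le> (2 * L + 1) * (\<bar>y t - z t'\<bar> + B * \<bar>t - t'\<bar> + T * L * \<delta>) + T * L * \<delta> + B * \<bar>t - t'\<bar>"
proof -
  define \<Delta> where "\<Delta> = 2 * (\<bar>y t - z t'\<bar> + B * \<bar>t - t'\<bar> + T * L * \<delta>)"
  have zz: "\<bar>z t' - z t\<bar> \<le> B * \<bar>t - t'\<bar>" using is_char_speed[OF z t(2,1)] by (simp add: abs_minus_commute)
  have \<Delta>: "\<bar>y s - z s\<bar> \<le> \<Delta>" if "s \<in> {0..T}" for s
  proof -
    have "\<bar>y s - z s\<bar> \<le> 2 * (\<bar>y t - z t\<bar> + T * L * \<delta>)"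
      using char_compare[OF u \<delta> y z t(1) that] by (simp only: mult.assoc)
    also have "\<bar>y t - z t\<bar> \<le> \<bar>y t - z t'\<bar> + B * \<bar>t - t'\<bar>" using zz by linarith
    finally show ?thesis unfolding \<Delta>_def by simp
  qed
  then have "\<Delta> \<ge> 0" using t(1) abs_ge_zero order_trans by blast
  have "\<delta> \<ge> 0" using \<delta> norm_ge_zero order_trans by blast
  have 0: "(0::real) \<in> {0..T}" using T by simp
  have "norm ((source u i y t - source v i z t) - (source u i y 0 - source v i z 0)) \<le> (K * \<Delta> + L * \<delta>) * \<bar>t - 0\<bar>"
  proof (rule vector_increment_bound[where S = "{0..T}"
        and f' = "\<lambda>s. g i s (y s, u (y s, s)) - g i s (z s, v (z s, s))"])
    fix s assume s: "s \<in> {0..T}"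
    show "((\<lambda>s. source u i y s - source v i z s) has_vector_derivative
        g i s (y s, u (y s, s)) - g i s (z s, v (z s, s))) (at s within {0..T})"
      by (intro has_vector_derivative_diff source_derivative u v y z s)
    show "norm (g i s (y s, u (y s, s)) - g i s (z s, v (z s, s))) \<le> K * \<Delta> + L * \<delta>"
      using lip_along(2)[OF u \<delta> s, of i "y s" "z s"] mult_left_mono[OF \<Delta>[OF s] K(1)] by simp
  qed (use t 0 in auto)
  also have "\<dots> \<le> (K * \<Delta> + L * \<delta>) * T"
    using t K L \<open>\<Delta> \<ge> 0\<close> \<open>\<delta> \<ge> 0\<close> by (intro mult_left_mono) auto
  also have "\<dots> = (K * T) * \<Delta> + T * L * \<delta>" by (simp add: algebra_simps)
  also have "\<dots> \<le> (1/2) * \<Delta> + T * L * \<delta>" using K \<open>\<Delta> \<ge> 0\<close> by (intro add_right_mono mult_right_mono)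
  finally have 1: "\<bar>source u i y t - source v i z t\<bar> \<le> \<Delta> / 2 + T * L * \<delta>" by (simp add: source_0)
  have "norm (source v i z t - source v i z t') \<le> B * \<bar>t - t'\<bar>"
    by (rule vector_increment_bound[OF source_derivative[OF v z]]) (use t bound_g in auto)
  then have 2: "\<bar>source v i z t - source v i z t'\<bar> \<le> B * \<bar>t - t'\<bar>" by simp
  have 3: "\<bar>f i (y 0) - f i (z 0)\<bar> \<le> L * \<Delta>"
    by (rule order_trans[OF lip_f mult_left_mono[OF \<Delta>[OF 0] L]])
  have "L * \<Delta> + \<Delta> / 2 = (2 * L + 1) * (\<bar>y t - z t'\<bar> + B * \<bar>t - t'\<bar> + T * L * \<delta>)"
    by (simp add: \<Delta>_def field_simps)
  then show ?thesis using 1 2 3 by linarith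
qed

lemma transport_bound:
  assumes "profile u" "is_char u i y" "t \<in> {0..T}"
  shows "\<bar>f i (y 0) + source u i y t\<bar> \<le> B + B * T"
proof -
  have "norm (source u i y t - source u i y 0) \<le> B * \<bar>t - 0\<bar>"
    by (rule vector_increment_bound[OF source_derivative[OF assms(1,2)]]) (use assms bound_g in auto)
  also have "\<dots> \<le> B * T" using assms(3) B_nonneg by (intro mult_left_mono) auto
  finally show ?thesis using bound_f[of i "y 0"] by (simp add: source_0)
qed

text \<open>
  Time is clamped to \<open>{0..T}\<close> so that the result is a bounded continuous function on the whole plane.
\<close>

definition transport :: "(real \<times> real \<Rightarrow> real^'n) \<Rightarrow> real \<times> real \<Rightarrow> real^'n" where
  "transport u = (\<lambda>(x, t). \<chi> i.
     f i (char u i (max 0 (min T t)) x 0) + source u i (char u i (max 0 (min T t)) x) (max 0 (min T t)))"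

lemma transport_diff:
  assumes u: "profile u" and v: "profile v" and \<delta>: "\<And>p. norm (u p - v p) \<le> \<delta>"
  shows "norm (transport u (x, t) - transport v (x', t')) \<le> CARD('n) *
    ((2 * L + 1) * (\<bar>x - x'\<bar> + B * \<bar>t - t'\<bar> + T * L * \<delta>) + T * L * \<delta> + B * \<bar>t - t'\<bar>)"
proof (rule norm_vec_le)
  fix i
  define r where "r = max 0 (min T t)"
  define r' where "r' = max 0 (min T t')"
  have r: "r \<in> {0..T}" "r' \<in> {0..T}" and rr: "\<bar>r - r'\<bar> \<le> \<bar>t - t'\<bar>"
    using T by (auto simp: r_def r'_def)
  have "\<bar>(transport u (x, t) - transport v (x', t')) $ i\<bar>
    = \<bar>(f i (char u i r x 0) + source u i (char u i r x) r)
       - (f i (char v i r' x' 0) + source v i (char v i r' x') r')\<bar>"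
    by (simp add: transport_def r_def r'_def)
  also have "\<dots> \<le> (2 * L + 1) * (\<bar>x - x'\<bar> + B * \<bar>r - r'\<bar> + T * L * \<delta>) + T * L * \<delta> + B * \<bar>r - r'\<bar>"
    using transport_compare[OF u v \<delta> char(2)[OF u r(1)] char(2)[OF v r(2)] r]
    by (simp add: char(1)[OF u r(1)] char(1)[OF v r(2)])
  also have "\<dots> \<le> (2 * L + 1) * (\<bar>x - x'\<bar> + B * \<bar>t - t'\<bar> + T * L * \<delta>) + T * L * \<delta> + B * \<bar>t - t'\<bar>"
    using rr L B_nonneg by (intro add_right_mono add_left_mono add_mono mult_left_mono) auto
  finally show "\<bar>(transport u (x, t) - transport v (x', t')) $ i\<bar> \<le> \<dots>" .
qed

lemma transport_profile:
  assumes u: "profile u"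
  shows "profile (transport u)" "bounded (range (transport u))"
proof -
  have lip: "norm (transport u (x, t) - transport u (x', t')) \<le>
      M * (\<bar>x - x'\<bar> + B * \<bar>t - t'\<bar>) + CARD('n) * (B * \<bar>t - t'\<bar>)" for x t x' t'
    using transport_diff[OF u u, of 0 x t x' t'] by (simp add: M algebra_simps)
  have "continuous (at (x', t')) (transport u)" for x' t'
    unfolding continuous_at
  proof (rule tendsto_dist_iff[THEN iffD2], rule tendsto_sandwich[OF _ _ tendsto_const])
    show "\<forall>\<^sub>F p in at (x', t'). dist (transport u p) (transport u (x', t'))
        \<le> M * (\<bar>fst p - x'\<bar> + B * \<bar>snd p - t'\<bar>) + CARD('n) * (B * \<bar>snd p - t'\<bar>)"
      by (rule always_eventually) (use lip in \<open>auto simp: dist_norm\<close>)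
    have "((\<lambda>p. M * (\<bar>fst p - x'\<bar> + B * \<bar>snd p - t'\<bar>) + CARD('n) * (B * \<bar>snd p - t'\<bar>)) \<longlongrightarrow>
       M * (\<bar>fst (x', t') - x'\<bar> + B * \<bar>snd (x', t') - t'\<bar>) + CARD('n) * (B * \<bar>snd (x', t') - t'\<bar>)) (at (x', t'))"
      by (intro tendsto_intros)
    then show "((\<lambda>p. M * (\<bar>fst p - x'\<bar> + B * \<bar>snd p - t'\<bar>) + CARD('n) * (B * \<bar>snd p - t'\<bar>)) \<longlongrightarrow> 0) (at (x', t'))"
      by simp
  qed auto
  then show "profile (transport u)"
    using lip[of _ t _ t for t] unfolding profile_def
    by (auto intro!: continuous_at_imp_continuous_on)
  have "norm (transport u p) \<le> CARD('n) * (B + B * T)" for p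
  proof (rule norm_vec_le)
    fix i
    define r where "r = max 0 (min T (snd p))"
    have r: "r \<in> {0..T}" using T by (auto simp: r_def)
    have "transport u p $ i = f i (char u i r (fst p) 0) + source u i (char u i r (fst p)) r"
      unfolding transport_def r_def case_prod_beta by simp
    then show "\<bar>transport u p $ i\<bar> \<le> B + B * T"
      using transport_bound[OF u char(2)[OF u r] r, of i "fst p"] by simp
  qed
  then show "bounded (range (transport u))" by (auto simp: bounded_iff)
qed

lemma ex_transport_fixed_point: "\<exists>u. profile u \<and> transport u = u"
proof -
  define S where "S = {u :: (real \<times> real) \<Rightarrow>\<^sub>C (real^'n). profile (apply_bcontfun u)}"
  define \<Phi> where "\<Phi> = (\<lambda>u. Bcontfun (transport (apply_bcontfun u)))"
  have \<Phi>: "apply_bcontfun (\<Phi> u) = transport (apply_bcontfun u)" if "u \<in> S" for u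
    using transport_profile[of "apply_bcontfun u"] that
    by (simp add: \<Phi>_def S_def Bcontfun_inverse bcontfun_def profile_def)
  have ev: "continuous_on UNIV (\<lambda>u :: (real \<times> real) \<Rightarrow>\<^sub>C (real^'n). apply_bcontfun u p)" for p
    by (rule lipschitz_on_continuous_on[of 1], rule lipschitz_onI) (auto simp: dist_bounded)
  have "S = {u. \<forall>x y t. norm (apply_bcontfun u (x, t) - apply_bcontfun u (y, t)) \<le> M * \<bar>x - y\<bar>}"
    by (auto simp: S_def profile_def)
  then have "closed S"
    by (auto intro!: closed_Collect_all closed_Collect_le continuous_intros ev)
  have "\<exists>!u. u \<in> S \<and> \<Phi> u = u"
  proof (rule Banach_fix[where c = "1/2"])
    show "complete S" using \<open>closed S\<close> by (simp add: complete_eq_closed)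
    have "const_bcontfun 0 \<in> S" using M_ge by (auto simp: S_def profile_def const_bcontfun.rep_eq)
    then show "S \<noteq> {}" by blast
    show "\<Phi> ` S \<subseteq> S" using transport_profile \<Phi> by (auto simp: S_def)
    show "dist (\<Phi> u) (\<Phi> v) \<le> 1/2 * dist u v" if "u \<in> S" "v \<in> S" for u v
    proof (rule dist_bound)
      fix p :: "real \<times> real"
      have "norm (apply_bcontfun u p - apply_bcontfun v p) \<le> dist u v" for p
        using dist_bounded[of u p v] by (simp add: dist_norm)
      then have "norm (transport (apply_bcontfun u) (fst p, snd p) - transport (apply_bcontfun v) (fst p, snd p))
          \<le> CARD('n) * ((2 * L + 1) * (T * L * dist u v) + T * L * dist u v)"
        using transport_diff[of "apply_bcontfun u" "apply_bcontfun v" "dist u v" "fst p" "snd p" "fst p" "snd p"] that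
        by (simp add: S_def)
      also have "\<dots> = (CARD('n) * (2 * L + 2)) * (T * L * dist u v)" by (simp add: algebra_simps)
      also have "\<dots> \<le> (2 * (1 + M)) * (T * L * dist u v)"
        using L T M by (intro mult_right_mono) (auto simp: algebra_simps)
      also have "\<dots> = 2 * (K * T) * dist u v" by (simp add: algebra_simps)
      also have "\<dots> \<le> 1/2 * dist u v" using K by (intro mult_right_mono) auto
      finally show "dist (apply_bcontfun (\<Phi> u) p) (apply_bcontfun (\<Phi> v) p) \<le> 1/2 * dist u v"
        using that by (simp add: \<Phi> dist_norm)
    qed
  qed auto
  then obtain u where "u \<in> S" "\<Phi> u = u" by blast
  then show ?thesis using \<Phi>[of u] by (auto simp: S_def)
qed

text \<open>
  The characteristic through \<open>(y s, s)\<close> is \<open>y\<close> itself, so the fixed point equation holds along the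
  whole of \<open>y\<close>, not just at the point at which the characteristic was chosen.
\<close>

lemma fixed_point_along_char:
  assumes u: "profile u" "transport u = u" and y: "is_char u i y" and s: "s \<in> {0..T}"
  shows "u (y s, s) $ i = f i (y 0) + source u i y s"
proof -
  have "u (y s, s) $ i = transport u (y s, s) $ i" by (simp add: u(2))
  also have "\<dots> = f i (char u i s (y s) 0) + source u i (char u i s (y s)) s"
    using s by (simp add: transport_def)
  finally show ?thesis
    using transport_compare[OF u(1) u(1) _ char(2)[OF u(1) s] y s s, of 0 "y s"] char(1)[OF u(1) s] by simp
qed

end

section \<open>Continuous differentiability of the fixed point\<close>

lemma product_derivative_at_zero:
  fixes h r :: "real \<Rightarrow> real"
  assumes "(h has_real_derivative D) (at t within S)" "h t = 0" "continuous (at t within S) r"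
  shows "((\<lambda>s. h s * r s) has_real_derivative D * r t) (at t within S)"
proof -
  have "((\<lambda>s. ((h s - h t) / (s - t)) * r s) \<longlongrightarrow> D * r t) (at t within S)"
    using assms(1,3) by (intro tendsto_mult) (auto simp: has_field_derivative_iff continuous_within)
  then show ?thesis using assms(2) by (simp add: has_field_derivative_iff)
qed

text \<open>
  Difference of two approximate right-hand sides of the Riccati equation \<open>Q' = a - Q \<alpha>\<close> for difference
  quotients: \<open>a\<close> and \<open>\<alpha>\<close> are the linearized source and speed, and \<open>e\<close> bounds the linearization errors.
\<close>

lemma riccati_difference_bound:
  fixes a :: real
  assumes "\<bar>gq - a\<bar> \<le> e" "\<bar>gr - b\<bar> \<le> e" "\<bar>lq - \<alpha>\<bar> \<le> e" "\<bar>lr - \<beta>\<bar> \<le> e"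
    and "\<bar>a - b\<bar> \<le> L * c" "\<bar>\<alpha> - \<beta>\<bar> \<le> L * c" "\<bar>\<alpha>\<bar> \<le> L * (1 + M)"
    and "\<bar>Q\<bar> \<le> M" "\<bar>R\<bar> \<le> M" "\<bar>Q - R\<bar> \<le> c" and pos: "0 \<le> M" "0 \<le> c" "0 \<le> L" "0 \<le> e"
  shows "\<bar>(gq - Q * lq) - (gr - R * lr)\<bar> \<le> 2 * (L * (1 + M)) * c + 2 * (1 + M) * e"
proof -
  have eq: "(gq - Q * lq) - (gr - R * lr)
      = (gq - a) - (gr - b) + (a - b) - Q * (lq - \<alpha>) + R * (lr - \<beta>) - (Q - R) * \<alpha> - R * (\<alpha> - \<beta>)"
    by (simp add: algebra_simps)
  have sum7: "\<bar>p1 - p2 + p3 - p4 + p5 - p6 - p7\<bar> \<le> a1 + a2 + a3 + a4 + a5 + a6 + a7"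
    if "\<bar>p1\<bar> \<le> a1" "\<bar>p2\<bar> \<le> a2" "\<bar>p3\<bar> \<le> a3" "\<bar>p4\<bar> \<le> a4" "\<bar>p5\<bar> \<le> a5" "\<bar>p6\<bar> \<le> a6" "\<bar>p7\<bar> \<le> a7"
    for p1 p2 p3 p4 p5 p6 p7 a1 a2 a3 a4 a5 a6 a7 :: real
    using that unfolding abs_le_iff by linarith
  have m: "\<bar>Q * (lq - \<alpha>)\<bar> \<le> M * e" "\<bar>R * (lr - \<beta>)\<bar> \<le> M * e" "\<bar>(Q - R) * \<alpha>\<bar> \<le> c * (L * (1 + M))"
    "\<bar>R * (\<alpha> - \<beta>)\<bar> \<le> M * (L * c)"
    unfolding abs_mult by (intro mult_mono assms abs_ge_zero)+
  have "\<bar>(gq - Q * lq) - (gr - R * lr)\<bar> \<le> e + e + L * c + M * e + M * e + c * (L * (1 + M)) + M * (L * c)"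
    unfolding eq by (rule sum7[OF assms(1,2,5) m])
  also have "\<dots> = 2 * (L * (1 + M)) * c + 2 * (1 + M) * e" by (simp add: algebra_simps)
  finally show ?thesis .
qed

text \<open>
  The existence of the fixed point rests on Lipschitz bounds, its regularity on uniform
  differentiability; the latter is therefore assumed separately, together with the fixed point.
\<close>

locale diagonal_solution = diagonal_system l g f B L T M
  for l g :: "'n::finite \<Rightarrow> real \<Rightarrow> real \<times> (real^'n) \<Rightarrow> real" and f B L T M +
  fixes l' g' :: "'n \<Rightarrow> real \<Rightarrow> real \<times> (real^'n) \<Rightarrow> real \<times> (real^'n) \<Rightarrow> real"
    and f' :: "'n \<Rightarrow> real \<Rightarrow> real" and u :: "real \<times> real \<Rightarrow> real^'n"
  assumes ud_l: "\<And>i. unif_diff_on {0..T} UNIV (l i) (l' i)"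
    and ud_g: "\<And>i. unif_diff_on {0..T} UNIV (g i) (g' i)"
    and ud_f: "\<And>i. unif_diff_on UNIV UNIV (\<lambda>_::unit. f i) (\<lambda>_ x v. f' i x * v)"
    and bound_l': "\<And>i t z v. t \<in> {0..T} \<Longrightarrow> \<bar>l' i t z v\<bar> \<le> L * norm v"
    and bound_g': "\<And>i t z v. t \<in> {0..T} \<Longrightarrow> \<bar>g' i t z v\<bar> \<le> L * norm v"
    and u: "profile u" "transport u = u"
begin

lemma linear_l': "t \<in> {0..T} \<Longrightarrow> linear (l' i t z)" and linear_g': "t \<in> {0..T} \<Longrightarrow> linear (g' i t z)"
  using ud_l[of i] ud_g[of i] unfolding unif_diff_on_def by blast+

definition quot :: "real \<Rightarrow> real \<Rightarrow> real \<Rightarrow> real^'n" where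
  "quot x y t = (1 / (x - y)) *\<^sub>R (u (x, t) - u (y, t))"

lemma norm_quot: "norm (quot x y t) \<le> M"
proof (cases "x = y")
  case False
  have "norm (u (x, t) - u (y, t)) \<le> M * \<bar>x - y\<bar>" using u(1) by (simp add: profile_def)
  then show ?thesis using False by (simp only: quot_def norm_scaleR) (simp add: pos_divide_le_eq)
qed (use M_ge in \<open>simp add: quot_def\<close>)

lemma quot_component: "quot x y t $ i = (u (x, t) $ i - u (y, t) $ i) / (x - y)"
  by (simp add: quot_def)

text \<open>
  The states at \<open>x\<close> and \<open>y\<close> differ by \<open>(x - y)\<close> times \<open>(1, quot x y t)\<close>. The difference quotient of a
  coefficient is therefore, up to \<open>e\<close>, an affine function of the quotient of \<open>u\<close>, and the equation for
  the latter along characteristics becomes a Riccati equation.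
\<close>

lemma difference_quotient_linearization:
  assumes ud: "unif_diff_on {0..T} UNIV c c'" and "e > 0"
  shows "\<exists>d>0. \<forall>t\<in>{0..T}. \<forall>x y. x \<noteq> y \<longrightarrow> \<bar>x - y\<bar> < d \<longrightarrow>
    \<bar>(c t (x, u (x, t)) - c t (y, u (y, t))) / (x - y) - c' t (x, u (x, t)) (1, quot x y t)\<bar> \<le> (e::real)"
proof -
  define e' where "e' = e / (1 + M)"
  have "e' > 0" using \<open>e > 0\<close> M_ge by (simp add: e'_def)
  with ud have "\<exists>d>0. \<forall>t\<in>{0..T}. \<forall>z\<in>UNIV. \<forall>w\<in>UNIV. norm (w - z) < d \<longrightarrow>
      norm (c t w - c t z - c' t z (w - z)) \<le> e' * norm (w - z)"
    unfolding unif_diff_on_def by (elim conjE allE) (erule mp)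
  then obtain d where "d > 0" and d: "\<forall>t\<in>{0..T}. \<forall>z\<in>UNIV. \<forall>w\<in>UNIV. norm (w - z) < d \<longrightarrow>
      norm (c t w - c t z - c' t z (w - z)) \<le> e' * norm (w - z)"
    by (elim exE conjE) (rule that)
  show ?thesis
  proof (intro exI[of _ "d / (1 + M)"] conjI ballI allI impI)
    show "d / (1 + M) > 0" using \<open>d > 0\<close> M_ge by simp
    fix t x y assume t: "t \<in> {0..T}" and "x \<noteq> y" and xy: "\<bar>x - y\<bar> < d / (1 + M)"
    define z where "z = (x, u (x, t))"
    define w where "w = (y, u (y, t))"
    have wz: "w - z = (-(x - y)) *\<^sub>R (1, quot x y t)"
    proof -
      have "(x - y) *\<^sub>R quot x y t = u (x, t) - u (y, t)" using \<open>x \<noteq> y\<close> by (simp add: quot_def)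
      then show ?thesis by (simp add: w_def z_def scaleR_diff_left[symmetric]) (simp add: algebra_simps)
    qed
    have "norm (z - w) \<le> (1 + M) * \<bar>x - y\<bar>"
      using profile_state_diff[OF u(1), of u 0 x t y] by (simp add: z_def w_def)
    then have nwz: "norm (w - z) \<le> (1 + M) * \<bar>x - y\<bar>" by (simp add: norm_minus_commute)
    also have "\<dots> < d" using xy M_ge by (simp add: field_simps)
    finally have "norm (c t w - c t z - c' t z (w - z)) \<le> e' * norm (w - z)"
      by (rule d[rule_format, OF t UNIV_I UNIV_I])
    also have "\<dots> \<le> e' * ((1 + M) * \<bar>x - y\<bar>)" using nwz \<open>e' > 0\<close> by (intro mult_left_mono) auto
    also have "\<dots> = e * \<bar>x - y\<bar>" using M_ge by (simp add: e'_def)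
    finally have 1: "\<bar>c t w - c t z - c' t z (w - z)\<bar> \<le> e * \<bar>x - y\<bar>" by simp
    have lin: "linear (c' t z)" using ud t unfolding unif_diff_on_def by blast
    have "c' t z (w - z) = - (x - y) * c' t z (1, quot x y t)"
      unfolding wz using linear_cmul[OF lin, of "- (x - y)" "(1, quot x y t)"] by (simp only: real_scaleR_def)
    then have "(c t z - c t w) / (x - y) - c' t z (1, quot x y t) = - (c t w - c t z - c' t z (w - z)) / (x - y)"
      using \<open>x \<noteq> y\<close> by (simp add: field_simps)
    then have "\<bar>(c t z - c t w) / (x - y) - c' t z (1, quot x y t)\<bar> = \<bar>c t w - c t z - c' t z (w - z)\<bar> / \<bar>x - y\<bar>"
      by (simp only: abs_divide abs_minus_cancel)
    also have "\<dots> \<le> e" using 1 \<open>x \<noteq> y\<close> by (simp add: pos_divide_le_eq)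
    finally show "\<bar>(c t (x, u (x, t)) - c t (y, u (y, t))) / (x - y) - c' t (x, u (x, t)) (1, quot x y t)\<bar> \<le> e"
      by (simp add: z_def w_def)
  qed
qed

lemma u_along_char:
  assumes "is_char u i y" "s \<in> {0..T}"
  shows "((\<lambda>s. u (y s, s) $ i) has_real_derivative g i s (y s, u (y s, s))) (at s within {0..T})"
proof -
  have "((\<lambda>s. f i (y 0) + source u i y s) has_vector_derivative g i s (y s, u (y s, s))) (at s within {0..T})"
    using source_derivative[OF u(1) assms] by (simp add: has_vector_derivative_add_const add.commute[of "f i (y 0)"])
  then have "((\<lambda>s. u (y s, s) $ i) has_vector_derivative g i s (y s, u (y s, s))) (at s within {0..T})"
    by (rule has_vector_derivative_transform[OF assms(2), rotated]) (rule fixed_point_along_char[OF u assms(1)])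
  then show ?thesis by (simp add: has_real_derivative_iff_has_vector_derivative)
qed

lemma u_initial: "u (x, 0) $ i = f i x"
proof -
  have "0 \<in> {0..T}" using T by simp
  from fixed_point_along_char[OF u char(2)[OF u(1) this] this, of i x] char(1)[OF u(1) this]
  show ?thesis by (simp add: source_0)
qed

definition oscillation_le :: "real \<Rightarrow> real \<Rightarrow> bool" where
  "oscillation_le c d \<longleftrightarrow> (\<forall>t\<in>{0..T}. \<forall>x y z. x \<noteq> y \<longrightarrow> x \<noteq> z \<longrightarrow> \<bar>x - y\<bar> < d \<longrightarrow> \<bar>x - z\<bar> < d \<longrightarrow>
     norm (quot x y t - quot x z t) \<le> c)"

text \<open>
  Let \<open>Q\<close> and \<open>R\<close> be the \<open>i\<close>-th components of \<open>q(X, Y)\<close> and \<open>q(X, Z)\<close> along three characteristics of the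
  \<open>i\<close>-th family. By \<open>riccati_difference_bound\<close> the derivative of \<open>Q - R\<close> is bounded by a multiple of \<open>c\<close>
  and an error that is small when the curves are close, and at time \<open>0\<close> the difference is small since
  the initial datum is differentiable. The time being short, this leaves a fraction of \<open>c\<close>. Starting
  from increments below \<open>m / 2\<close> keeps the curves within \<open>m\<close> of each other on \<open>{0..T}\<close>.
\<close>

lemma oscillation_shrinks:
  assumes cd: "oscillation_le c d" and "c > 0" "d > 0"
  shows "\<exists>d'>0. oscillation_le (3/4 * c) d'"
proof -
  \<comment> \<open>with this \<open>e\<close>, the linearization errors and the error at time \<open>0\<close> contribute \<open>c / 2\<close> in total\<close>
  define e where "e = c / 8 / (CARD('n) * (1 + M))"
  have "e > 0" using \<open>c > 0\<close> M_ge by (simp add: e_def)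
  let ?lin = "\<lambda>c c' d. \<forall>t\<in>{0..T}. \<forall>x y. x \<noteq> y \<longrightarrow> \<bar>x - y\<bar> < d \<longrightarrow>
    \<bar>(c t (x, u (x, t)) - c t (y, u (y, t))) / (x - y) - c' t (x, u (x, t)) (1, quot x y t)\<bar> \<le> e"
  obtain dl where "dl > 0" and dl: "\<forall>i. ?lin (l i) (l' i) dl"
    using uniform_radius[of "\<lambda>i d. ?lin (l i) (l' i) d"] difference_quotient_linearization[OF ud_l \<open>e > 0\<close>]
    by fastforce
  obtain dg where "dg > 0" and dg: "\<forall>i. ?lin (g i) (g' i) dg"
    using uniform_radius[of "\<lambda>i d. ?lin (g i) (g' i) d"] difference_quotient_linearization[OF ud_g \<open>e > 0\<close>]
    by fastforce
  have "\<exists>d>0. \<forall>i x y. \<bar>y - x\<bar> < d \<longrightarrow> \<bar>f i y - f i x - f' i x * (y - x)\<bar> \<le> e * \<bar>y - x\<bar>"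
  proof (rule uniform_radius)
    fix i show "\<exists>d>0. \<forall>x y. \<bar>y - x\<bar> < d \<longrightarrow> \<bar>f i y - f i x - f' i x * (y - x)\<bar> \<le> e * \<bar>y - x\<bar>"
      using ud_f[of i] \<open>e > 0\<close> unfolding unif_diff_on_def by auto
  qed auto
  then obtain df where "df > 0"
    and df: "\<And>i x y. \<bar>y - x\<bar> < df \<Longrightarrow> \<bar>f i y - f i x - f' i x * (y - x)\<bar> \<le> e * \<bar>y - x\<bar>" by blast
  have df': "\<bar>(f i x - f i y) / (x - y) - f' i x\<bar> \<le> e" if "x \<noteq> y" "\<bar>x - y\<bar> < df" for i x y
  proof -
    have "(f i x - f i y) / (x - y) - f' i x = (f i y - f i x - f' i x * (y - x)) / (y - x)"
      using that by (simp add: field_simps)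
    then show ?thesis using df[of y x i] that by (simp add: abs_divide pos_divide_le_eq abs_minus_commute)
  qed
  define m where "m = min (min d df) (min dl dg)"
  have "m > 0" and m: "m \<le> d" "m \<le> df" "m \<le> dl" "m \<le> dg"
    using \<open>d > 0\<close> \<open>df > 0\<close> \<open>dl > 0\<close> \<open>dg > 0\<close> by (auto simp: m_def)
  have "oscillation_le (3/4 * c) (m / 2)"
    unfolding oscillation_le_def
  proof (intro ballI allI impI)
    fix t x y z assume t: "t \<in> {0..T}" and xy: "x \<noteq> y" "\<bar>x - y\<bar> < m / 2" and xz: "x \<noteq> z" "\<bar>x - z\<bar> < m / 2"
    have 0: "(0::real) \<in> {0..T}" using T by simp
    have comp: "\<bar>(quot x y t - quot x z t) $ i\<bar> \<le> 2 * e + (2 * K * c + 2 * (1 + M) * e) * T" for i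
    proof -
      define X where "X = char u i t x"
      \<comment> \<open>characteristics of one family issued from distinct points stay distinct and at most double their distance\<close>
      have X: "is_char u i X" "X t = x" using char[OF u(1) t] by (simp_all add: X_def)
      have sep: "X s \<noteq> Y s \<and> \<bar>X s - Y s\<bar> < m"
        if "is_char u i Y" "x \<noteq> Y t" "\<bar>x - Y t\<bar> < m / 2" "s \<in> {0..T}" for Y s
      proof -
        have "\<bar>X s - Y s\<bar> \<le> 2 * \<bar>X t - Y t\<bar>" "\<bar>X t - Y t\<bar> \<le> 2 * \<bar>X s - Y s\<bar>"
          using char_compare[OF u(1) _ X(1) that(1), of 0] that(4) t by auto
        then show ?thesis using that(2,3) X(2) by auto
      qed
      define D where "D = (\<lambda>Y s. (g i s (X s, u (X s, s)) - g i s (Y s, u (Y s, s))) / (X s - Y s)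
         - quot (X s) (Y s) s $ i * ((l i s (X s, u (X s, s)) - l i s (Y s, u (Y s, s))) / (X s - Y s)))"
      have der: "((\<lambda>s. quot (X s) (Y s) s $ i) has_vector_derivative D Y s) (at s within {0..T})"
        if Y: "is_char u i Y" "x \<noteq> Y t" "\<bar>x - Y t\<bar> < m / 2" and s: "s \<in> {0..T}" for Y s
      proof -
        have ne: "X s - Y s \<noteq> 0" using sep[OF Y s] by simp
        have quotient: "(a * w - n * b) / (w * w) = a / w - n / w * (b / w)" if "w \<noteq> 0" for a b n w :: real
          using that by (simp add: diff_divide_distrib)
        have N: "((\<lambda>s. u (X s, s) $ i - u (Y s, s) $ i) has_real_derivative
            g i s (X s, u (X s, s)) - g i s (Y s, u (Y s, s))) (at s within {0..T})"
          by (intro DERIV_diff u_along_char X Y s)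
        have W: "((\<lambda>s. X s - Y s) has_real_derivative
            l i s (X s, u (X s, s)) - l i s (Y s, u (Y s, s))) (at s within {0..T})"
          using X(1) Y(1) s unfolding is_char_def by (intro DERIV_diff) auto
        have "((\<lambda>s. quot (X s) (Y s) s $ i) has_real_derivative D Y s) (at s within {0..T})"
          unfolding quot_component D_def by (rule DERIV_cong[OF DERIV_divide[OF N W ne] quotient[OF ne]])
        then show ?thesis by (simp add: has_real_derivative_iff_has_vector_derivative)
      qed
      define Y where "Y = char u i t y"
      define Z where "Z = char u i t z"
      have Y: "is_char u i Y" "x \<noteq> Y t" "\<bar>x - Y t\<bar> < m / 2" and Yt: "Y t = y"
        and Z: "is_char u i Z" "x \<noteq> Z t" "\<bar>x - Z t\<bar> < m / 2" and Zt: "Z t = z"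
        using char[OF u(1) t] xy xz by (simp_all add: Y_def Z_def)
      have "norm ((quot (X t) (Y t) t $ i - quot (X t) (Z t) t $ i) - (quot (X 0) (Y 0) 0 $ i - quot (X 0) (Z 0) 0 $ i))
          \<le> (2 * K * c + 2 * (1 + M) * e) * \<bar>t - 0\<bar>"
      proof (rule vector_increment_bound[where S = "{0..T}" and f' = "\<lambda>s. D Y s - D Z s"])
        fix s assume s: "s \<in> {0..T}"
        show "((\<lambda>s. quot (X s) (Y s) s $ i - quot (X s) (Z s) s $ i) has_vector_derivative D Y s - D Z s) (at s within {0..T})"
          by (intro has_vector_derivative_diff der Y Z s)
        let ?q = "quot (X s) (Y s) s" and ?r = "quot (X s) (Z s) s" and ?z = "(X s, u (X s, s))"
        have sY: "X s \<noteq> Y s" "\<bar>X s - Y s\<bar> < m" and sZ: "X s \<noteq> Z s" "\<bar>X s - Z s\<bar> < m"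
          using sep[OF Y s] sep[OF Z s] by auto
        have qr: "norm (?q - ?r) \<le> c" using cd sY sZ m s unfolding oscillation_le_def by auto
        have n1: "norm ((1::real, ?q) - (1, ?r)) = norm (?q - ?r)" by simp
        have n2: "norm (1::real, ?q) \<le> 1 + M"
          using norm_Pair_le[of "1::real" ?q] norm_quot[of "X s" "Y s" s] by simp
        have "\<bar>D Y s - D Z s\<bar> \<le> 2 * (L * (1 + M)) * c + 2 * (1 + M) * e"
          unfolding D_def
        proof (rule riccati_difference_bound[where a = "g' i s ?z (1, ?q)" and b = "g' i s ?z (1, ?r)"
              and \<alpha> = "l' i s ?z (1, ?q)" and \<beta> = "l' i s ?z (1, ?r)"])
          show "\<bar>(g i s ?z - g i s (Y s, u (Y s, s))) / (X s - Y s) - g' i s ?z (1, ?q)\<bar> \<le> e"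
            "\<bar>(g i s ?z - g i s (Z s, u (Z s, s))) / (X s - Z s) - g' i s ?z (1, ?r)\<bar> \<le> e"
            using dg s sY sZ m by auto
          show "\<bar>(l i s ?z - l i s (Y s, u (Y s, s))) / (X s - Y s) - l' i s ?z (1, ?q)\<bar> \<le> e"
            "\<bar>(l i s ?z - l i s (Z s, u (Z s, s))) / (X s - Z s) - l' i s ?z (1, ?r)\<bar> \<le> e"
            using dl s sY sZ m by auto
          have Lc: "L * norm ((1::real, ?q) - (1, ?r)) \<le> L * c"
            unfolding n1 using qr L by (intro mult_left_mono)
          show "\<bar>g' i s ?z (1, ?q) - g' i s ?z (1, ?r)\<bar> \<le> L * c"
            using linear_diff[OF linear_g'[OF s], of i ?z "(1, ?q)" "(1, ?r)"]
              bound_g'[OF s, of i ?z "(1, ?q) - (1, ?r)"] Lc by linarith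
          show "\<bar>l' i s ?z (1, ?q) - l' i s ?z (1, ?r)\<bar> \<le> L * c"
            using linear_diff[OF linear_l'[OF s], of i ?z "(1, ?q)" "(1, ?r)"]
              bound_l'[OF s, of i ?z "(1, ?q) - (1, ?r)"] Lc by linarith
          show "\<bar>l' i s ?z (1, ?q)\<bar> \<le> L * (1 + M)"
            by (rule order_trans[OF bound_l'[OF s] mult_left_mono[OF n2 L]])
          show "\<bar>?q $ i\<bar> \<le> M" "\<bar>?r $ i\<bar> \<le> M"
            by (rule order_trans[OF component_le_norm_cart norm_quot])+
          show "\<bar>?q $ i - ?r $ i\<bar> \<le> c"
            using order_trans[OF component_le_norm_cart[of "?q - ?r" i] qr] by simp
        qed (use M_ge \<open>c > 0\<close> \<open>e > 0\<close> L in auto)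
        then show "norm (D Y s - D Z s) \<le> 2 * K * c + 2 * (1 + M) * e" by simp
      qed (use t 0 in auto)
      also have "\<dots> \<le> (2 * K * c + 2 * (1 + M) * e) * T"
        using t K M_ge \<open>c > 0\<close> \<open>e > 0\<close> by (intro mult_left_mono) auto
      finally have 1: "\<bar>(quot x y t $ i - quot x z t $ i) - (quot (X 0) (Y 0) 0 $ i - quot (X 0) (Z 0) 0 $ i)\<bar>
          \<le> (2 * K * c + 2 * (1 + M) * e) * T" by (simp add: X Yt Zt)
      have "\<bar>quot (X 0) (Y 0) 0 $ i - f' i (X 0)\<bar> \<le> e" "\<bar>quot (X 0) (Z 0) 0 $ i - f' i (X 0)\<bar> \<le> e"
        using sep[OF Y 0] sep[OF Z 0] m df' by (auto simp: quot_component u_initial)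
      then have "\<bar>quot (X 0) (Y 0) 0 $ i - quot (X 0) (Z 0) 0 $ i\<bar> \<le> 2 * e" by linarith
      with 1 show ?thesis by (simp add: abs_le_iff)
    qed
    have "norm (quot x y t - quot x z t) \<le> CARD('n) * (2 * e + (2 * K * c + 2 * (1 + M) * e) * T)"
      by (rule norm_vec_le[OF comp])
    also have "\<dots> \<le> CARD('n) * (2 * (1 + M) * e + 2 * (K * T) * c + 2 * (1 + M) * e)"
    proof (rule mult_left_mono)
      have "(2 * (1 + M) * e) * T \<le> (2 * (1 + M) * e) * 1" using T M_ge \<open>e > 0\<close> by (intro mult_left_mono) auto
      moreover have "2 * e \<le> 2 * (1 + M) * e" using M_ge \<open>e > 0\<close> by simp
      ultimately show "2 * e + (2 * K * c + 2 * (1 + M) * e) * T \<le> 2 * (1 + M) * e + 2 * (K * T) * c + 2 * (1 + M) * e"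
        by (simp add: algebra_simps)
    qed simp
    also have "\<dots> = 4 * (CARD('n) * (1 + M) * e) + 2 * (CARD('n) * (K * T)) * c" by (simp add: algebra_simps)
    also have "CARD('n) * (1 + M) * e = c / 8"
    proof -
      have "v * (w / v) = w" if "v \<noteq> 0" for v w :: real using that by simp
      then show ?thesis unfolding e_def using M_ge by (metis add_pos_nonneg mult_eq_0_iff less_irrefl of_nat_eq_0_iff zero_less_card_finite zero_less_one)
    qed
    also have "2 * (CARD('n) * (K * T)) * c \<le> 2 * (1/8) * c"
      using K(4) \<open>c > 0\<close> by (intro mult_right_mono mult_left_mono) auto
    finally show "norm (quot x y t - quot x z t) \<le> 3/4 * c" by simp
  qed
  then show ?thesis using \<open>m > 0\<close> by (intro exI[of _ "m / 2"]) auto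
qed

lemma quot_uniformly_cauchy:
  assumes "e > 0"
  shows "\<exists>d>0. oscillation_le e d"
proof -
  have "\<exists>d>0. oscillation_le ((3/4)^k * (2 * M)) d" for k
  proof (induction k)
    case 0
    have "norm (quot x y t - quot x z t) \<le> 2 * M" for x y z t
      using norm_triangle_ineq4[of "quot x y t" "quot x z t"] norm_quot[of x y t] norm_quot[of x z t] by linarith
    then show ?case by (intro exI[of _ 1]) (auto simp: oscillation_le_def)
  next
    case (Suc k)
    then obtain d where "d > 0" "oscillation_le ((3/4)^k * (2 * M)) d" by blast
    from oscillation_shrinks[OF this(2) _ this(1)] show ?case using M_ge by (simp add: mult.assoc)
  qed
  moreover obtain k where "(3/4::real)^k < e / (2 * M)"
    using real_arch_pow_inv[of "e / (2 * M)" "3/4"] assms M_ge by auto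
  then have "(3/4)^k * (2 * M) \<le> e" using M_ge by (simp add: field_simps)
  ultimately show ?thesis unfolding oscillation_le_def by (meson order_trans)
qed

definition slope :: "real \<times> real \<Rightarrow> real^'n" where
  "slope = (\<lambda>(x, t). lim (\<lambda>k. quot x (x + 1 / Suc k) t))"

lemma slope_uniform:
  assumes "e > 0"
  shows "\<exists>d>0. \<forall>t\<in>{0..T}. \<forall>x y. x \<noteq> y \<longrightarrow> \<bar>x - y\<bar> < d \<longrightarrow> norm (quot x y t - slope (x, t)) \<le> e"
proof -
  have small: "\<forall>\<^sub>F k in sequentially. 1 / real (Suc k) < d" if "d > 0" for d
    using order_tendstoD(2)[OF LIMSEQ_inverse_real_of_nat that] by (simp add: inverse_eq_divide)
  have conv: "(\<lambda>k. quot x (x + 1 / Suc k) t) \<longlonglongrightarrow> slope (x, t)" if t: "t \<in> {0..T}" for x t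
  proof -
    have "Cauchy (\<lambda>k. quot x (x + 1 / Suc k) t)"
      unfolding Cauchy_altdef2
    proof (intro allI impI)
      fix e :: real assume "e > 0"
      then obtain d where "d > 0" and d: "oscillation_le (e / 2) d" using quot_uniformly_cauchy[of "e / 2"] by auto
      obtain N where N: "\<And>k. k \<ge> N \<Longrightarrow> 1 / real (Suc k) < d"
        using small[OF \<open>d > 0\<close>] unfolding eventually_sequentially by blast
      have "norm (quot x (x + 1 / Suc n) t - quot x (x + 1 / Suc N) t) \<le> e / 2" if "n \<ge> N" for n
        using d t N[OF that] N[of N] unfolding oscillation_le_def by auto
      then show "\<exists>N. \<forall>n\<ge>N. dist (quot x (x + 1 / Suc n) t) (quot x (x + 1 / Suc N) t) < e"
        using \<open>e > 0\<close> by (intro exI[of _ N]) (force simp: dist_norm)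
    qed
    then show ?thesis
      unfolding slope_def using convergent_LIMSEQ_iff Cauchy_convergent by auto
  qed
  obtain d where "d > 0" and d: "oscillation_le e d" using quot_uniformly_cauchy[OF assms] by blast
  have "norm (quot x y t - slope (x, t)) \<le> e" if t: "t \<in> {0..T}" and xy: "x \<noteq> y" "\<bar>x - y\<bar> < d" for t x y
  proof (rule tendsto_upperbound)
    show "(\<lambda>k. norm (quot x y t - quot x (x + 1 / Suc k) t)) \<longlonglongrightarrow> norm (quot x y t - slope (x, t))"
      by (intro tendsto_intros conv t)
    show "\<forall>\<^sub>F k in sequentially. norm (quot x y t - quot x (x + 1 / Suc k) t) \<le> e"
      using small[OF \<open>d > 0\<close>] by eventually_elim (use d t xy in \<open>auto simp: oscillation_le_def\<close>)
  qed simp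
  then show ?thesis using \<open>d > 0\<close> by blast
qed

lemma slope_continuous: "continuous_on (UNIV \<times> {0..T}) slope"
proof (rule uniform_limit_theorem)
  show "uniform_limit (UNIV \<times> {0..T}) (\<lambda>k p. quot (fst p) (fst p + 1 / Suc k) (snd p)) slope sequentially"
  proof (rule uniform_limitI)
    fix e :: real assume "e > 0"
    then obtain d where "d > 0" and d: "\<And>t x y. t \<in> {0..T} \<Longrightarrow> x \<noteq> y \<Longrightarrow> \<bar>x - y\<bar> < d \<Longrightarrow>
        norm (quot x y t - slope (x, t)) \<le> e / 2"
      using slope_uniform[of "e / 2"] by auto
    have "\<forall>\<^sub>F k in sequentially. 1 / real (Suc k) < d"
      using order_tendstoD(2)[OF LIMSEQ_inverse_real_of_nat \<open>d > 0\<close>] by (simp add: inverse_eq_divide)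
    then show "\<forall>\<^sub>F k in sequentially. \<forall>p\<in>UNIV \<times> {0..T}.
        dist (quot (fst p) (fst p + 1 / Suc k) (snd p)) (slope p) < e"
    proof eventually_elim
      case (elim k)
      have "dist (quot x (x + 1 / Suc k) t) (slope (x, t)) < e" if "t \<in> {0..T}" for x t
        using d[OF that, of x "x + 1 / Suc k"] elim \<open>e > 0\<close> by (simp add: dist_norm)
      then show ?case by auto
    qed
  qed
  have contu: "continuous_on UNIV u" using u(1) by (simp add: profile_def)
  have 1: "continuous_on S (\<lambda>p. u (fst p + c, snd p))" for S c
    by (rule continuous_on_compose2[OF contu]) (auto intro!: continuous_intros)
  have "continuous_on (UNIV \<times> {0..T}) (\<lambda>p. quot (fst p) (fst p + 1 / Suc k) (snd p))" for k
    unfolding quot_def using 1[of _ 0] 1[of _ "1 / Suc k"] by (auto intro!: continuous_intros)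
  then show "\<forall>\<^sub>F k in sequentially. continuous_on (UNIV \<times> {0..T}) (\<lambda>p. quot (fst p) (fst p + 1 / Suc k) (snd p))"
    by simp
qed simp

lemma space_derivative:
  assumes t: "t \<in> {0..T}"
  shows "((\<lambda>y. u (y, t)) has_vector_derivative slope (x, t)) (at x)"
  unfolding has_vector_derivative_def has_derivative_at_alt
proof (intro conjI allI impI)
  show "bounded_linear (\<lambda>r. r *\<^sub>R slope (x, t))" by (rule bounded_linear_scaleR_left)
  fix e :: real assume "e > 0"
  then obtain d where "d > 0" and d: "\<And>y. x \<noteq> y \<Longrightarrow> \<bar>x - y\<bar> < d \<Longrightarrow> norm (quot x y t - slope (x, t)) \<le> e"
    using slope_uniform[OF \<open>e > 0\<close>] t by blast
  have "norm (u (y, t) - u (x, t) - (y - x) *\<^sub>R slope (x, t)) \<le> e * norm (y - x)" if "norm (y - x) < d" for y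
  proof (cases "y = x")
    case False
    have "u (y, t) - u (x, t) - (y - x) *\<^sub>R slope (x, t) = (y - x) *\<^sub>R (quot x y t - slope (x, t))"
      using False by (simp add: quot_def scaleR_diff_right divide_inverse nonzero_inverse_minus_eq minus_diff_eq[symmetric, of x y] del: minus_diff_eq)
    then show ?thesis using d[of y] False that
      by (simp add: abs_minus_commute mult.commute[of e] mult_left_mono)
  qed simp
  then show "\<exists>d>0. \<forall>y. norm (y - x) < d \<longrightarrow>
      norm (u (y, t) - u (x, t) - (y - x) *\<^sub>R slope (x, t)) \<le> e * norm (y - x)"
    using \<open>d > 0\<close> by blast
qed

text \<open>
  With \<open>X\<close> the characteristic through \<open>(x, t)\<close>, write \<open>u\<^sub>i(x, s) = u\<^sub>i(X s, s) - (X s - x) r s\<close>. The first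
  term has derivative \<open>g\<^sub>i\<close>. The factor \<open>X s - x\<close> vanishes at \<open>s = t\<close>, so the second term has derivative
  \<open>l\<^sub>i r t\<close> as soon as \<open>r\<close> is continuous at \<open>t\<close>; this is where uniform convergence of the difference
  quotients is used.
\<close>

lemma time_derivative:
  assumes t: "t \<in> {0..T}"
  shows "((\<lambda>s. u (x, s) $ i) has_real_derivative
     g i t (x, u (x, t)) - l i t (x, u (x, t)) * slope (x, t) $ i) (at t within {0..T})"
proof -
  define X where "X = char u i t x"
  have X: "is_char u i X" "X t = x" using char[OF u(1) t] by (simp_all add: X_def)
  \<comment> \<open>\<open>r\<close> interpolates the slope between \<open>x\<close> and the point \<open>X s\<close> of the characteristic\<close>
  define r where "r = (\<lambda>s. if X s = x then slope (x, s) $ i else quot x (X s) s $ i)"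
  have eq: "u (x, s) $ i = u (X s, s) $ i - (X s - x) * r s" for s
    by (simp add: r_def quot_component field_simps)
  have Xcont: "(X \<longlongrightarrow> x) (at t within {0..T})"
    using is_char_continuous[OF X(1)] t X(2) by (metis continuous_on)
  have "((\<lambda>s. slope (x, s)) \<longlongrightarrow> slope (x, t)) (at t within {0..T})"
  proof -
    have "continuous_on {0..T} (\<lambda>s. slope (x, s))"
      by (rule continuous_on_compose2[OF slope_continuous]) (auto intro!: continuous_intros)
    then show ?thesis using t by (simp add: continuous_on)
  qed
  then have sl: "((\<lambda>s. slope (x, s) $ i) \<longlongrightarrow> slope (x, t) $ i) (at t within {0..T})"
    by (rule tendsto_vec_nth)
  have "((\<lambda>s. r s - slope (x, s) $ i) \<longlongrightarrow> 0) (at t within {0..T})"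
  proof (rule tendstoI)
    fix e :: real assume "e > 0"
    then obtain d where "d > 0" and d: "\<And>t x y. t \<in> {0..T} \<Longrightarrow> x \<noteq> y \<Longrightarrow> \<bar>x - y\<bar> < d \<Longrightarrow>
        norm (quot x y t - slope (x, t)) \<le> e / 2"
      using slope_uniform[of "e / 2"] by auto
    have "\<forall>\<^sub>F s in at t within {0..T}. s \<in> {0..T}" by (simp add: eventually_at_topological) blast
    then show "\<forall>\<^sub>F s in at t within {0..T}. dist (r s - slope (x, s) $ i) 0 < e"
      using tendstoD[OF Xcont \<open>d > 0\<close>]
    proof eventually_elim
      case (elim s)
      have "\<bar>(quot x (X s) s - slope (x, s)) $ i\<bar> \<le> e / 2" if "X s \<noteq> x"
        using order_trans[OF component_le_norm_cart d[of s x "X s"]] elim that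
        by (simp add: dist_real_def abs_minus_commute)
      then show ?case using \<open>e > 0\<close> by (auto simp: r_def dist_real_def)
    qed
  qed
  from tendsto_add[OF this sl] have "(r \<longlongrightarrow> slope (x, t) $ i) (at t within {0..T})" by simp
  then have "continuous (at t within {0..T}) r" by (simp add: continuous_within r_def X(2))
  moreover have "((\<lambda>s. X s - x) has_real_derivative l i t (x, u (x, t))) (at t within {0..T})"
    using X t unfolding is_char_def by (auto intro!: derivative_eq_intros)
  ultimately have "((\<lambda>s. (X s - x) * r s) has_real_derivative l i t (x, u (x, t)) * r t) (at t within {0..T})"
    by (intro product_derivative_at_zero) (simp_all add: X(2))
  from DERIV_diff[OF u_along_char[OF X(1) t] this] show ?thesis
    unfolding eq[symmetric] by (simp add: X(2) r_def)
qed

text \<open>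
  A bound for \<open>u\<close> in terms of the data and of \<open>B * T\<close> only. The radius at which the coefficients are
  truncated can thus be fixed before \<open>B\<close>, which depends on it.
\<close>

lemma u_near_initial_data:
  assumes t: "t \<in> {0..T}"
  shows "\<exists>y. \<bar>u (x, t) $ i - f i y\<bar> \<le> B * T"
proof -
  define X where "X = char u i t x"
  have X: "is_char u i X" "X t = x" using char[OF u(1) t] by (simp_all add: X_def)
  have "norm (source u i X t - source u i X 0) \<le> B * \<bar>t - 0\<bar>"
    by (rule vector_increment_bound[OF source_derivative[OF u(1) X(1)]]) (use t bound_g in auto)
  also have "\<dots> \<le> B * T" using t B_nonneg by (intro mult_left_mono) auto
  finally show ?thesis
    using fixed_point_along_char[OF u X(1) t] X(2) by (intro exI[of _ "X 0"]) (simp add: source_0)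
qed

end

lemma ex_diagonal_solution:
  fixes l g :: "'n::finite \<Rightarrow> real \<Rightarrow> real \<times> (real^'n) \<Rightarrow> real"
  assumes ud_l: "\<And>i. unif_diff_on {0..1} UNIV (l i) (l' i)"
    and ud_g: "\<And>i. unif_diff_on {0..1} UNIV (g i) (g' i)"
    and ud_f: "\<And>i. unif_diff_on UNIV UNIV (\<lambda>_::unit. f i) (\<lambda>_ x v. f' i x * v)"
    and cont_l: "\<And>i. continuous_on ({0..1} \<times> UNIV) (\<lambda>(t, z). l i t z)"
    and cont_g: "\<And>i. continuous_on ({0..1} \<times> UNIV) (\<lambda>(t, z). g i t z)"
    and bound_l: "\<And>i t z. t \<in> {0..1} \<Longrightarrow> \<bar>l i t z\<bar> \<le> B"
    and bound_g: "\<And>i t z. t \<in> {0..1} \<Longrightarrow> \<bar>g i t z\<bar> \<le> B"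
    and bound_f: "\<And>i x. \<bar>f i x\<bar> \<le> B"
    and \<tau>: "\<tau> > 0"
  shows "\<exists>L T M u. T \<le> \<tau> \<and> diagonal_solution l g f B L T M l' g' f' u"
proof -
  have "\<exists>L\<ge>0. \<forall>i. common_bound {0..1} UNIV (l i) (l' i) L"
    by (intro uniform_bound unif_diff_on_common_bound ud_l convex_UNIV) (rule common_bound_mono)
  then obtain Ll where Ll: "Ll \<ge> 0" "\<And>i. common_bound {0..1} UNIV (l i) (l' i) Ll" by blast
  have "\<exists>L\<ge>0. \<forall>i. common_bound {0..1} UNIV (g i) (g' i) L"
    by (intro uniform_bound unif_diff_on_common_bound ud_g convex_UNIV) (rule common_bound_mono)
  then obtain Lg where Lg: "\<And>i. common_bound {0..1} UNIV (g i) (g' i) Lg" by blast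
  have "\<exists>L\<ge>0. \<forall>i. common_bound UNIV UNIV (\<lambda>_::unit. f i) (\<lambda>_ x v. f' i x * v) L"
    by (intro uniform_bound unif_diff_on_common_bound ud_f convex_UNIV) (rule common_bound_mono)
  then obtain Lf where Lf: "\<And>i. common_bound UNIV UNIV (\<lambda>_::unit. f i) (\<lambda>_ x v. f' i x * v) Lf" by blast
  define L where "L = max Ll (max Lg Lf)"
  have L: "L \<ge> 0" using Ll(1) by (auto simp: L_def)
  have bl: "common_bound {0..1} UNIV (l i) (l' i) L" and bg: "common_bound {0..1} UNIV (g i) (g' i) L"
    and bf: "common_bound UNIV UNIV (\<lambda>_::unit. f i) (\<lambda>_ x v. f' i x * v) L" for i
    by (rule common_bound_mono[OF Ll(2)] common_bound_mono[OF Lg] common_bound_mono[OF Lf], simp add: L_def)+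
  define M where "M = CARD('n) * (2 * L + 1)"
  define C where "C = CARD('n) * (L * (1 + M))"
  have "M \<ge> 0" using L by (simp add: M_def)
  then have "C \<ge> 0" using L by (simp add: C_def)
  define T where "T = min (min 1 \<tau>) (1 / (8 * (C + 1)))"
  have T: "0 < T" "T \<le> 1" "T \<le> \<tau>" using \<tau> \<open>C \<ge> 0\<close> by (auto simp: T_def)
  have "C * T \<le> C * (1 / (8 * (C + 1)))" using \<open>C \<ge> 0\<close> by (intro mult_left_mono) (auto simp: T_def)
  also have "\<dots> \<le> 1/8" using \<open>C \<ge> 0\<close> by (simp add: field_simps)
  finally have CT: "C * T \<le> 1/8" .
  have sub: "{0..T} \<subseteq> {0..1}" using T by auto
  have t1: "t \<in> {0..1}" if "t \<in> {0..T}" for t using sub that by blast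
  interpret S: diagonal_system l g f B L T M
  proof
    show "continuous_on ({0..T} \<times> UNIV) (\<lambda>(t, z). l i t z)" "continuous_on ({0..T} \<times> UNIV) (\<lambda>(t, z). g i t z)" for i
      using sub by (blast intro: continuous_on_subset[OF cont_l] continuous_on_subset[OF cont_g])+
    show "\<bar>l i t z - l i t w\<bar> \<le> L * norm (z - w)" "\<bar>g i t z - g i t w\<bar> \<le> L * norm (z - w)" if "t \<in> {0..T}" for i t z w
      using bl[of i] bg[of i] t1[OF that] unfolding common_bound_def real_norm_def by blast+
    show "\<bar>f i x - f i y\<bar> \<le> L * \<bar>x - y\<bar>" for i x y
      using bf[of i] unfolding common_bound_def by simp
    show "CARD('n) * (L * (1 + M)) * T \<le> 1/8" using CT by (simp add: C_def)
    show "M = CARD('n) * (2 * L + 1)" by (rule M_def)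
  qed (use T L bound_l bound_g bound_f t1 in blast)+
  obtain u where u: "S.profile u" "S.transport u = u" using S.ex_transport_fixed_point by blast
  have "diagonal_solution l g f B L T M l' g' f' u"
  proof (unfold_locales)
    show "unif_diff_on {0..T} UNIV (l i) (l' i)" "unif_diff_on {0..T} UNIV (g i) (g' i)" for i
      using unif_diff_on_subset[OF ud_l sub] unif_diff_on_subset[OF ud_g sub] by blast+
    show "\<bar>l' i t z v\<bar> \<le> L * norm v" "\<bar>g' i t z v\<bar> \<le> L * norm v" if "t \<in> {0..T}" for i t z v
      using bl[of i] bg[of i] t1[OF that] unfolding common_bound_def real_norm_def by blast+
  qed (use u ud_f in blast)+
  then show ?thesis using T by blast
qed

section \<open>Uniqueness on the domain of determinacy\<close>

lemma Basis_real_pair: "(Basis :: (real \<times> real) set) = {(1, 0), (0, 1)}"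
  by (auto simp: Basis_prod_def)

lemma diag_mat_mult: "(diag_mat d *v w) $ i = d i * w $ i"
  by (simp add: diag_mat_def matrix_vector_mult_def mult_delta_left)

lemma det_dom_bounds:
  assumes "(x, t) \<in> det_dom a b \<Lambda> T" "\<Lambda> \<ge> 0"
  shows "t \<in> {0..T}" "x \<in> {a..b}"
proof -
  show "t \<in> {0..T}" using assms(1) by (simp add: det_dom_def)
  then have "\<Lambda> * t \<ge> 0" using assms(2) by simp
  then show "x \<in> {a..b}" using assms(1) by (auto simp: det_dom_def)
qed

lemma compact_det_dom:
  assumes "\<Lambda> \<ge> 0"
  shows "compact (det_dom a b \<Lambda> T)"
proof -
  have "closed {p :: real \<times> real. 0 \<le> snd p \<and> snd p \<le> T \<and> a + \<Lambda> * snd p \<le> fst p \<and> fst p \<le> b - \<Lambda> * snd p}"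
    by (intro closed_Collect_conj closed_Collect_le continuous_intros)
  moreover have "det_dom a b \<Lambda> T = {p :: real \<times> real. 0 \<le> snd p \<and> snd p \<le> T \<and> a + \<Lambda> * snd p \<le> fst p \<and> fst p \<le> b - \<Lambda> * snd p}"
    by (auto simp: det_dom_def)
  moreover have "det_dom a b \<Lambda> T \<subseteq> {a..b} \<times> {0..T}" using det_dom_bounds[OF _ assms] by auto
  ultimately show ?thesis
    using compact_Int_closed[OF compact_Times[OF compact_Icc compact_Icc]] by (metis inf.absorb_iff2)
qed

lemma interior_det_dom:
  assumes "0 < t" "t < T" "a + \<Lambda> * t < x" "x < b - \<Lambda> * t"
  shows "(x, t) \<in> interior (det_dom a b \<Lambda> T)"
proof -
  define U where "U = {p :: real \<times> real. 0 < snd p \<and> snd p < T \<and> a + \<Lambda> * snd p < fst p \<and> fst p < b - \<Lambda> * snd p}"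
  have "open U" unfolding U_def by (intro open_Collect_conj open_Collect_less continuous_intros)
  moreover have "U \<subseteq> det_dom a b \<Lambda> T" by (auto simp: U_def det_dom_def)
  moreover have "(x, t) \<in> U" using assms by (simp add: U_def)
  ultimately show ?thesis using interior_maximal by blast
qed

lemma interior_det_dom_time:
  assumes "(x, t) \<in> interior (det_dom a b \<Lambda> T)"
  shows "0 < t" "t < T"
proof -
  have "det_dom a b \<Lambda> T \<subseteq> UNIV \<times> {0..T}" by (auto simp: det_dom_def)
  then have "interior (det_dom a b \<Lambda> T) \<subseteq> UNIV \<times> {0<..<T}"
    using interior_mono[of _ "UNIV \<times> {0..T}"] by (simp add: interior_Times)
  then show "0 < t" "t < T" using assms by auto
qed

lemma lipschitz_on_cball:
  fixes F :: "'n \<Rightarrow> real \<times> real \<times> (real^'n) \<Rightarrow> real"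
  assumes "\<And>i. C1_on coeff_dom (F i)"
  shows "\<exists>L\<ge>0. \<forall>i. \<forall>t\<in>{0..1}. \<forall>x u w. norm (x, u) \<le> R \<longrightarrow> norm (x, w) \<le> R \<longrightarrow>
    \<bar>F i (x, t, u) - F i (x, t, w)\<bar> \<le> L * norm (u - w)"
proof (rule uniform_bound)
  fix i
  obtain F' where "unif_diff_on {0..1} (cball 0 R) (\<lambda>t z. F i (fst z, t, snd z)) F'"
    using coefficient_unif_diff_on_compact[OF assms compact_cball convex_cball] by blast
  from unif_diff_on_lipschitz[OF this convex_cball]
  obtain L where "L \<ge> 0" and L: "\<forall>t\<in>{0..1}. \<forall>z\<in>cball 0 R. \<forall>w\<in>cball 0 R.
      norm (F i (fst z, t, snd z) - F i (fst w, t, snd w)) \<le> L * norm (z - w)" by blast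
  have "\<bar>F i (x, t, u) - F i (x, t, w)\<bar> \<le> L * norm (u - w)"
    if "t \<in> {0..1}" "norm (x, u) \<le> R" "norm (x, w) \<le> R" for t x u w
    using L[rule_format, of t "(x, u)" "(x, w)"] that by simp
  then show "\<exists>L\<ge>0. \<forall>t\<in>{0..1}. \<forall>x u w. norm (x, u) \<le> R \<longrightarrow> norm (x, w) \<le> R \<longrightarrow>
      \<bar>F i (x, t, u) - F i (x, t, w)\<bar> \<le> L * norm (u - w)"
    using \<open>L \<ge> 0\<close> by blast
qed (meson mult_right_mono norm_ge_zero order_trans)

lemma solution_along_curve:
  fixes v :: "real \<times> real \<Rightarrow> real^'n"
  assumes vx: "has_partial_on D v (1, 0) vx" and vt: "has_partial_on D v (0, 1) vt"
    and X: "(X has_real_derivative c) (at s)" "(X s, s) \<in> interior D"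
  shows "((\<lambda>s. v (X s, s) $ i) has_real_derivative c * vx (X s, s) $ i + vt (X s, s) $ i) (at s)"
proof -
  define g where "g = (\<lambda>b::real \<times> real. if b = (1, 0) then vx else vt)"
  have "has_partial_on D v b (g b)" if "b \<in> Basis" for b
    using that vx vt by (auto simp: g_def Basis_real_pair)
  from continuous_partials_imp_has_derivative[OF this X(2)]
  have "(v has_derivative (\<lambda>w. fst w *\<^sub>R vx (X s, s) + snd w *\<^sub>R vt (X s, s))) (at (X s, s))"
    by (simp add: Basis_real_pair g_def inner_prod_def)
  moreover have "((\<lambda>s. (X s, s)) has_derivative (\<lambda>r. (c * r, r))) (at s)"
    using X(1) by (auto intro!: derivative_eq_intros simp: has_field_derivative_def)
  ultimately have "((\<lambda>s. v (X s, s)) has_derivative (\<lambda>r. (c * r) *\<^sub>R vx (X s, s) + r *\<^sub>R vt (X s, s))) (at s)"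
    using has_derivative_compose[of "\<lambda>s. (X s, s)" _ s UNIV v] by fastforce
  from bounded_linear.has_derivative[OF bounded_linear_vec_nth this]
  show ?thesis unfolding has_field_derivative_def by (rule has_derivative_eq_rhs) (auto simp: algebra_simps)
qed

text \<open>
  The characteristics are those of \<open>u\<close>, along which \<open>v\<close> solves
  \<open>v\<^sub>i' = h\<^sub>i(v) - (\<lambda>\<^sub>i(v) - \<lambda>\<^sub>i(u)) v\<^sub>i\<^sub>x\<close>. With \<open>e = v - u\<close> this gives \<open>\<bar>e\<^sub>i'\<bar> \<le> K norm e\<close>. If \<open>N\<close> is the maximum
  of \<open>exp (- \<kappa> t) norm e\<close>, integration yields \<open>\<bar>e\<^sub>i\<bar> \<le> K / \<kappa> N exp (\<kappa> t)\<close>, and the choice of \<open>\<kappa>\<close> turns this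
  into \<open>N \<le> N / 2\<close>.
\<close>

lemma classical_solution_unique:
  fixes u v h :: "_ \<Rightarrow> real^'n"
  assumes ab: "a < b" and T: "0 < T" "T \<le> 1" and \<Lambda>: "\<Lambda> \<ge> 0"
    and D: "D = det_dom a b \<Lambda> T"
    and A: "\<And>p. p \<in> coeff_dom \<Longrightarrow> A p = diag_mat (\<lambda>i. lam i p)"
    and C1: "\<And>i. C1_on coeff_dom (lam i)" "\<And>i. C1_on coeff_dom (\<lambda>p. h p $ i)"
    and contu: "continuous_on D u" and u0: "\<And>x. x \<in> {a..b} \<Longrightarrow> u (x, 0) = ubar x"
    and chars: "\<And>x t i. (x, t) \<in> D \<Longrightarrow> 0 < t \<Longrightarrow> \<exists>X. X t = x \<and> continuous_on {0..t} X \<and>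
      (\<forall>s\<in>{0..t}. (X s, s) \<in> D) \<and> (\<forall>s\<in>{0<..<t}. (X s, s) \<in> interior D \<and>
        (X has_real_derivative lam i (X s, s, u (X s, s))) (at s) \<and>
        ((\<lambda>s. u (X s, s) $ i) has_real_derivative h (X s, s, u (X s, s)) $ i) (at s))"
    and v: "classical_solution a b D A h ubar v"
  shows "\<forall>p\<in>D. v p = u p"
proof -
  obtain vx vt where vx: "has_partial_on D v (1, 0) vx" and vt: "has_partial_on D v (0, 1) vt"
    and eq: "\<And>x t. (x, t) \<in> D \<Longrightarrow> vt (x, t) + A (x, t, v (x, t)) *v vx (x, t) = h (x, t, v (x, t))"
    and v0: "\<And>x. x \<in> {a..b} \<Longrightarrow> v (x, 0) = ubar x" and contv: "continuous_on D v"
    using v unfolding classical_solution_def C1_on_def by blast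
  have comD: "compact D" using compact_det_dom[OF \<Lambda>] by (simp add: D)
  have Dt: "t \<in> {0..T}" "t \<in> {0..1}" "x \<in> {a..b}" if "(x, t) \<in> D" for x t
    using det_dom_bounds[of x t a b \<Lambda> T] that \<Lambda> T by (auto simp: D)
  have cv: "continuous_on D (\<lambda>p. (fst p, v p))" and cu: "continuous_on D (\<lambda>p. (fst p, u p))"
    by (intro continuous_on_Pair continuous_on_fst continuous_on_id contu contv)+
  have "\<exists>B. \<forall>p\<in>D. norm (fst p, v p) \<le> B" "\<exists>B. \<forall>p\<in>D. norm (fst p, u p) \<le> B"
    using continuous_on_compact_bound[OF comD cv] continuous_on_compact_bound[OF comD cu] by metis+
  then obtain R1 R2 where R1: "\<And>p. p \<in> D \<Longrightarrow> norm (fst p, v p) \<le> R1"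
    and R2: "\<And>p. p \<in> D \<Longrightarrow> norm (fst p, u p) \<le> R2" by blast
  define R where "R = max R1 R2"
  have R: "norm (x, v (x, t)) \<le> R" "norm (x, u (x, t)) \<le> R" if "(x, t) \<in> D" for x t
    using R1[OF that] R2[OF that] by (auto simp: R_def)
  obtain L1 where L1: "L1 \<ge> 0" "\<forall>i. \<forall>t\<in>{0..1}. \<forall>x u w. norm (x, u) \<le> R \<longrightarrow> norm (x, w) \<le> R \<longrightarrow>
    \<bar>lam i (x, t, u) - lam i (x, t, w)\<bar> \<le> L1 * norm (u - w)"
    using lipschitz_on_cball[of lam R, OF C1(1)] by blast
  obtain L2 where L2: "L2 \<ge> 0" "\<forall>i. \<forall>t\<in>{0..1}. \<forall>x u w. norm (x, u) \<le> R \<longrightarrow> norm (x, w) \<le> R \<longrightarrow>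
    \<bar>h (x, t, u) $ i - h (x, t, w) $ i\<bar> \<le> L2 * norm (u - w)"
    using lipschitz_on_cball[of "\<lambda>i p. h p $ i" R, OF C1(2)] by blast
  have "continuous_on D vx" using vx by (simp add: has_partial_on_def)
  then obtain C where "C \<ge> 0" and C: "\<And>p. p \<in> D \<Longrightarrow> norm (vx p) \<le> C"
    using continuous_on_compact_bound[OF comD] by metis
  define K where "K = L2 + L1 * C + 1"
  have "K > 0" using L1(1) L2(1) \<open>C \<ge> 0\<close> by (simp add: K_def add_nonneg_pos)
  define \<kappa> where "\<kappa> = 2 * CARD('n) * K"
  have "\<kappa> > 0" using \<open>K > 0\<close> by (simp add: \<kappa>_def)
  define e where "e = (\<lambda>p. v p - u p)"
  define \<phi> where "\<phi> = (\<lambda>p. exp (- \<kappa> * snd p) * norm (e p))"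
  have "continuous_on D \<phi>" unfolding \<phi>_def e_def using contu contv by (intro continuous_intros)
  moreover have "(a, 0) \<in> D" using ab T by (simp add: D det_dom_def)
  ultimately obtain p0 where p0: "p0 \<in> D" and max: "\<And>p. p \<in> D \<Longrightarrow> \<phi> p \<le> \<phi> p0"
    using continuous_attains_sup[OF comD, of \<phi>] by blast
  define N where "N = \<phi> p0"
  have "N \<ge> 0" by (simp add: N_def \<phi>_def)
  have eN: "norm (e (x, t)) \<le> N * exp (\<kappa> * t)" if "(x, t) \<in> D" for x t
    using max[OF that] by (simp add: N_def[symmetric]) (simp add: \<phi>_def exp_minus field_simps)
  have comp: "\<bar>e (x, t) $ i\<bar> \<le> K / \<kappa> * N * exp (\<kappa> * t)" if xt: "(x, t) \<in> D" for x t i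
  proof (cases "t = 0")
    case True
    then have "e (x, t) = 0" using u0[of x] v0[of x] Dt[OF xt] by (simp add: e_def)
    then show ?thesis using \<open>K > 0\<close> \<open>\<kappa> > 0\<close> \<open>N \<ge> 0\<close> by simp
  next
    case False
    then have "0 < t" using Dt(1)[OF xt] by simp
    then obtain X where X: "X t = x" "continuous_on {0..t} X" "\<And>s. s \<in> {0..t} \<Longrightarrow> (X s, s) \<in> D"
      "\<And>s. s \<in> {0<..<t} \<Longrightarrow> (X s, s) \<in> interior D"
      "\<And>s. s \<in> {0<..<t} \<Longrightarrow> (X has_real_derivative lam i (X s, s, u (X s, s))) (at s)"
      "\<And>s. s \<in> {0<..<t} \<Longrightarrow> ((\<lambda>s. u (X s, s) $ i) has_real_derivative h (X s, s, u (X s, s)) $ i) (at s)"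
      using chars[OF xt, of i] by blast
    define d where "d = (\<lambda>s. lam i (X s, s, u (X s, s)) * vx (X s, s) $ i + vt (X s, s) $ i - h (X s, s, u (X s, s)) $ i)"
    have "norm (e (X t, t) $ i - e (X 0, 0) $ i) \<le> K / \<kappa> * N * exp (\<kappa> * t) - K / \<kappa> * N * exp (\<kappa> * 0)"
    proof (rule differentiable_bound_general[OF \<open>0 < t\<close>, where f' = d and \<phi>' = "\<lambda>s. K * N * exp (\<kappa> * s)"
          and f = "\<lambda>s. e (X s, s) $ i" and \<phi> = "\<lambda>s. K / \<kappa> * N * exp (\<kappa> * s)"])
      have "continuous_on {0..t} (\<lambda>s. e (X s, s))"
        unfolding e_def
        by (intro continuous_on_diff continuous_on_compose2[OF contv] continuous_on_compose2[OF contu]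
            continuous_on_Pair X(2) continuous_on_id) (use X(3) in auto)
      then show "continuous_on {0..t} (\<lambda>s. e (X s, s) $ i)" by (intro continuous_intros)
      show "continuous_on {0..t} (\<lambda>s. K / \<kappa> * N * exp (\<kappa> * s))" by (intro continuous_intros)
      fix s assume "0 < s" "s < t"
      then have s: "s \<in> {0<..<t}" "s \<in> {0..t}" by auto
      show "((\<lambda>s. K / \<kappa> * N * exp (\<kappa> * s)) has_vector_derivative K * N * exp (\<kappa> * s)) (at s)"
        unfolding has_real_derivative_iff_has_vector_derivative[symmetric]
        using \<open>\<kappa> > 0\<close> by (auto intro!: derivative_eq_intros)
      show "((\<lambda>s. e (X s, s) $ i) has_vector_derivative d s) (at s)"
        using DERIV_diff[OF solution_along_curve[OF vx vt X(5,4)[OF s(1)], of i] X(6)[OF s(1)]]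
        unfolding has_real_derivative_iff_has_vector_derivative[symmetric] by (simp add: e_def d_def)
      have D: "(X s, s) \<in> D" and s1: "s \<in> {0..1}" using X(3)[OF s(2)] Dt(2)[OF X(3)[OF s(2)]] by auto
      have cd: "(X s, s, v (X s, s)) \<in> coeff_dom" using s by (simp add: coeff_dom_def)
      have "vt (X s, s) $ i + lam i (X s, s, v (X s, s)) * vx (X s, s) $ i = h (X s, s, v (X s, s)) $ i"
        using arg_cong[OF eq[OF D], of "\<lambda>w. w $ i"] A[OF cd] by (simp add: diag_mat_mult)
      then have d: "d s = (h (X s, s, v (X s, s)) $ i - h (X s, s, u (X s, s)) $ i)
          - (lam i (X s, s, v (X s, s)) - lam i (X s, s, u (X s, s))) * vx (X s, s) $ i"
        by (simp add: d_def algebra_simps)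
      have 1: "\<bar>h (X s, s, v (X s, s)) $ i - h (X s, s, u (X s, s)) $ i\<bar> \<le> L2 * norm (e (X s, s))"
        using L2(2) s1 R[OF D] by (simp add: e_def)
      have "\<bar>lam i (X s, s, v (X s, s)) - lam i (X s, s, u (X s, s))\<bar> \<le> L1 * norm (e (X s, s))"
        using L1(2) s1 R[OF D] by (simp add: e_def)
      then have 2: "\<bar>(lam i (X s, s, v (X s, s)) - lam i (X s, s, u (X s, s))) * vx (X s, s) $ i\<bar>
          \<le> (L1 * norm (e (X s, s))) * C"
        unfolding abs_mult using order_trans[OF component_le_norm_cart C[OF D]] L1(1)
        by (intro mult_mono) auto
      have "norm (d s) \<le> L2 * norm (e (X s, s)) + (L1 * norm (e (X s, s))) * C"
        unfolding d real_norm_def by (rule order_trans[OF abs_triangle_ineq4 add_mono[OF 1 2]])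
      also have "\<dots> \<le> K * norm (e (X s, s))" by (simp add: K_def algebra_simps)
      also have "\<dots> \<le> K * (N * exp (\<kappa> * s))" using eN[OF D] \<open>K > 0\<close> by (intro mult_left_mono) auto
      finally show "norm (d s) \<le> K * N * exp (\<kappa> * s)" by (simp add: mult.assoc)
    qed
    moreover have "e (X 0, 0) = 0"
      using u0[of "X 0"] v0[of "X 0"] Dt(3)[OF X(3)[of 0]] \<open>0 < t\<close> by (simp add: e_def)
    moreover have "K / \<kappa> * N \<ge> 0" using \<open>K > 0\<close> \<open>\<kappa> > 0\<close> \<open>N \<ge> 0\<close> by simp
    ultimately show ?thesis by (simp add: X(1))
  qed
  have "N \<le> 0"
  proof -
    obtain x t where xt: "p0 = (x, t)" by (cases p0)
    have "norm (e (x, t)) \<le> CARD('n) * (K / \<kappa> * N * exp (\<kappa> * t))"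
      using comp p0 by (intro norm_vec_le) (simp add: xt)
    also have "\<dots> = N / 2 * exp (\<kappa> * t)" using \<open>K > 0\<close> by (simp add: \<kappa>_def)
    finally have "N \<le> N / 2" by (simp add: N_def xt \<phi>_def exp_minus field_simps)
    then show ?thesis by simp
  qed
  show ?thesis
  proof
    fix p assume "p \<in> D"
    then have "norm (e p) \<le> 0" using eN[of "fst p" "snd p"] \<open>N \<le> 0\<close> \<open>N \<ge> 0\<close> by simp
    then show "v p = u p" by (simp add: e_def)
  qed
qed

section \<open>Local existence and uniqueness\<close>

theorem theorem0p1:
  fixes a b :: real
    and A :: "real \<times> real \<times> (real^'n) \<Rightarrow> real^'n^'n"
    and lam :: "'n \<Rightarrow> real \<times> real \<times> (real^'n) \<Rightarrow> real"
    and h :: "real \<times> real \<times> (real^'n) \<Rightarrow> real^'n"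
    and ubar :: "real \<Rightarrow> real^'n"
  assumes "a < b"
    and "\<forall>p\<in>coeff_dom. A p = diag_mat (\<lambda>i. lam i p)"
    and "\<forall>p\<in>coeff_dom. \<forall>i j. i \<noteq> j \<longrightarrow> lam i p \<noteq> lam j p"
    and "C1_on coeff_dom A" and "loc_lipschitz_partials_on coeff_dom A"
    and "C1_on coeff_dom h" and "loc_lipschitz_partials_on coeff_dom h"
    and "C1_on {a..b} ubar"
  shows "\<exists>\<Lambda>>0. \<exists>T>0. \<exists>u.
           classical_solution a b (det_dom a b \<Lambda> T) A h ubar u \<and>
           (\<forall>v w. classical_solution a b (det_dom a b \<Lambda> T) A h ubar v \<longrightarrow>
                  classical_solution a b (det_dom a b \<Lambda> T) A h ubar w \<longrightarrow>
                  (\<forall>p\<in>det_dom a b \<Lambda> T. v p = w p))"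
proof -
  define \<mu> where "\<mu> = (\<lambda>i p. A p $ i $ i)"
  have A: "A p = diag_mat (\<lambda>i. \<mu> i p)" if "p \<in> coeff_dom" for p
    using assms(2) that by (simp add: \<mu>_def diag_mat_def)
  have C1: "C1_on coeff_dom (\<mu> i)" "C1_on coeff_dom (\<lambda>p. h p $ i)" "C1_on {a..b} (\<lambda>x. ubar x $ i)" for i
    unfolding \<mu>_def
    by (intro C1_on_bounded_linear[of _ _ "\<lambda>w. w $ i"] C1_on_bounded_linear[of _ _ "\<lambda>w. w $ i $ i"]
        assms bounded_linear_vec_nth bounded_linear_compose[OF bounded_linear_vec_nth bounded_linear_vec_nth])+
  have "\<forall>i. \<exists>F d C. (\<forall>x\<in>{a..b}. F x = ubar x $ i) \<and> (\<forall>x. \<bar>F x\<bar> \<le> C) \<and>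
     unif_diff_on UNIV UNIV (\<lambda>_::unit. F) (\<lambda>_ x v. d x * v)"
    using extend_initial_data[OF C1(3) assms(1)] by blast
  then obtain f f' Cf where f: "\<And>i x. x \<in> {a..b} \<Longrightarrow> f i x = ubar x $ i" "\<And>i x. \<bar>f i x\<bar> \<le> Cf i"
    and ud_f: "\<And>i. unif_diff_on UNIV UNIV (\<lambda>_::unit. f i) (\<lambda>_ x v. f' i x * v)"
    by metis
  obtain Bf where "Bf \<ge> 0" and Bf: "\<And>i x. \<bar>f i x\<bar> \<le> Bf"
  proof -
    have "\<exists>B\<ge>0. \<forall>i x. \<bar>f i x\<bar> \<le> B"
      using f(2) by (intro uniform_bound) (meson abs_ge_zero order_trans)+
    then show ?thesis using that by blast
  qed
  \<comment> \<open>on the domain of determinacy, the states \<open>(x, u (x, t))\<close> will stay in the ball of radius \<open>R\<close>\<close>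
  define R where "R = \<bar>a\<bar> + \<bar>b\<bar> + CARD('n) * (Bf + 1) + 1"
  have "R > 0" using \<open>Bf \<ge> 0\<close> by (simp add: R_def add_nonneg_pos)
  have "\<forall>i. \<exists>l l' C. unif_diff_on {0..1} UNIV l l' \<and> continuous_on ({0..1} \<times> UNIV) (\<lambda>(t, z). l t z) \<and>
     (\<forall>t\<in>{0..1}. \<forall>z. \<bar>l t z\<bar> \<le> C) \<and> (\<forall>t\<in>{0..1}. \<forall>z. norm z \<le> R \<longrightarrow> l t z = \<mu> i (fst z, t, snd z))"
    using global_coefficient[OF C1(1) \<open>R > 0\<close>] by blast
  then obtain l l' Cl where ud_l: "\<And>i. unif_diff_on {0..1} UNIV (l i) (l' i)"
    and cont_l: "\<And>i. continuous_on ({0..1} \<times> UNIV) (\<lambda>(t, z). l i t z)"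
    and Cl: "\<And>i. \<forall>t\<in>{0..1}. \<forall>z. \<bar>l i t z\<bar> \<le> Cl i"
    and l: "\<And>i. \<forall>t\<in>{0..1}. \<forall>z. norm z \<le> R \<longrightarrow> l i t z = \<mu> i (fst z, t, snd z)"
    by metis
  have "\<forall>i. \<exists>l l' C. unif_diff_on {0..1} UNIV l l' \<and> continuous_on ({0..1} \<times> UNIV) (\<lambda>(t, z). l t z) \<and>
     (\<forall>t\<in>{0..1}. \<forall>z. \<bar>l t z\<bar> \<le> C) \<and> (\<forall>t\<in>{0..1}. \<forall>z. norm z \<le> R \<longrightarrow> l t z = h (fst z, t, snd z) $ i)"
    using global_coefficient[OF C1(2) \<open>R > 0\<close>] by blast
  then obtain g g' Cg where ud_g: "\<And>i. unif_diff_on {0..1} UNIV (g i) (g' i)"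
    and cont_g: "\<And>i. continuous_on ({0..1} \<times> UNIV) (\<lambda>(t, z). g i t z)"
    and Cg: "\<And>i. \<forall>t\<in>{0..1}. \<forall>z. \<bar>g i t z\<bar> \<le> Cg i"
    and g: "\<And>i. \<forall>t\<in>{0..1}. \<forall>z. norm z \<le> R \<longrightarrow> g i t z = h (fst z, t, snd z) $ i"
    by metis
  have "\<exists>B\<ge>0. \<forall>i. Cl i \<le> B \<and> Cg i \<le> B \<and> Bf \<le> B"
  proof (rule uniform_bound)
    show "\<exists>L\<ge>0. Cl i \<le> L \<and> Cg i \<le> L \<and> Bf \<le> L" for i
      by (rule exI[of _ "max (max (Cl i) (Cg i)) Bf"]) (use \<open>Bf \<ge> 0\<close> in auto)
  qed auto
  then obtain B where "B \<ge> 0" and B: "\<And>i. Cl i \<le> B" "\<And>i. Cg i \<le> B" "Bf \<le> B" by blast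
  have bl: "\<bar>l i t z\<bar> \<le> B" and bg: "\<bar>g i t z\<bar> \<le> B" if "t \<in> {0..1}" for i t z
    using Cl[of i] Cg[of i] B that order_trans by blast+
  have bf: "\<bar>f i x\<bar> \<le> B" for i x using Bf[of i x] B(3) by linarith
  obtain L T M u where T\<tau>: "T \<le> 1 / (B + 1)" and sol: "diagonal_solution l g f B L T M l' g' f' u"
  proof -
    have "1 / (B + 1) > 0" using \<open>B \<ge> 0\<close> by simp
    from ex_diagonal_solution[of l l' g g' f f', OF ud_l ud_g ud_f cont_l cont_g bl bg bf this]
    show ?thesis using that by blast
  qed
  interpret diagonal_solution l g f B L T M l' g' f' u by (rule sol)
  define \<Lambda> where "\<Lambda> = B + 1"
  have "\<Lambda> > 0" using \<open>B \<ge> 0\<close> by (simp add: \<Lambda>_def)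
  define D where "D = det_dom a b \<Lambda> T"
  have Dx: "x \<in> {a..b}" and Dt: "t \<in> {0..T}" "t \<in> {0..1}" if "(x, t) \<in> D" for x t
    using det_dom_bounds[of x t a b \<Lambda> T] that \<open>\<Lambda> > 0\<close> T by (auto simp: D_def)
  have BT: "B * T \<le> 1"
  proof -
    have "B * T \<le> B * (1 / (B + 1))" using T\<tau> \<open>B \<ge> 0\<close> by (rule mult_left_mono)
    also have "\<dots> \<le> 1" using \<open>B \<ge> 0\<close> by (simp add: field_simps)
    finally show ?thesis .
  qed
  have state: "norm (x, u (x, t)) \<le> R" if xt: "(x, t) \<in> D" for x t
  proof -
    have "\<bar>u (x, t) $ i\<bar> \<le> Bf + 1" for i
    proof -
      obtain y where "\<bar>u (x, t) $ i - f i y\<bar> \<le> B * T"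
        using u_near_initial_data[OF Dt(1)[OF xt]] by blast
      then show ?thesis using Bf[of i y] BT by linarith
    qed
    then have "norm (u (x, t)) \<le> CARD('n) * (Bf + 1)" by (rule norm_vec_le)
    then show ?thesis using norm_Pair_le[of x "u (x, t)"] Dx[OF that] by (auto simp: R_def)
  qed
  have lD: "l i t (x, u (x, t)) = \<mu> i (x, t, u (x, t))" and gD: "g i t (x, u (x, t)) = h (x, t, u (x, t)) $ i"
    if "(x, t) \<in> D" for i x t
    using l g Dt(2)[OF that] state[OF that] by auto
  have contu: "continuous_on S u" for S using u(1) continuous_on_subset by (auto simp: profile_def)
  define ut where "ut = (\<lambda>(x, t). \<chi> i. g i t (x, u (x, t)) - l i t (x, u (x, t)) * slope (x, t) $ i)"
  have sub: "D \<subseteq> UNIV \<times> {0..T}" using Dt by auto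
  have cont_slope: "continuous_on D slope" by (rule continuous_on_subset[OF slope_continuous sub])
  have ux: "has_partial_on D u (1, 0) slope"
    unfolding has_partial_on_def
  proof (intro conjI ballI cont_slope)
    fix p assume "p \<in> interior D"
    then obtain x t where p: "p = (x, t)" and t: "t \<in> {0..T}"
      using interior_subset[of D] Dt by (cases p) auto
    have "((\<lambda>y. u (y, t)) \<circ> (\<lambda>s. x + s) has_vector_derivative 1 *\<^sub>R slope (x, t)) (at 0)"
      by (rule vector_diff_chain_at) (use space_derivative[OF t] in \<open>auto intro!: derivative_eq_intros\<close>)
    then show "((\<lambda>s. u (p + s *\<^sub>R (1, 0))) has_vector_derivative slope p) (at 0)"
      by (simp add: p o_def)
  qed
  have ut: "has_partial_on D u (0, 1) ut"
    unfolding has_partial_on_def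
  proof (intro conjI ballI)
    have state_cont: "continuous_on D (\<lambda>p. (snd p, (fst p, u p)))"
      by (intro continuous_on_Pair continuous_on_fst continuous_on_snd continuous_on_id contu)
    have state_dom: "(\<lambda>p. (snd p, (fst p, u p))) ` D \<subseteq> {0..T} \<times> UNIV" using sub by auto
    have "continuous_on D (\<lambda>p. l i (snd p) (fst p, u p))" "continuous_on D (\<lambda>p. g i (snd p) (fst p, u p))" for i
      using continuous_on_compose2[OF cont_l state_cont state_dom, of i]
        continuous_on_compose2[OF cont_g state_cont state_dom, of i] by simp_all
    then show "continuous_on D ut"
      unfolding ut_def case_prod_beta using cont_slope by (intro continuous_on_vec_lambda continuous_intros) auto
    fix p assume p0: "p \<in> interior D"
    then obtain x t where p: "p = (x, t)" by (cases p)
    have t: "0 < t" "t < T" using p0 interior_det_dom_time[of x t] by (auto simp: p D_def)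
    have "((\<lambda>s. u (x, s)) has_vector_derivative ut p) (at t)"
      unfolding has_vector_derivative_def
    proof (subst has_derivative_componentwise_within, intro ballI)
      fix w :: "real^'n" assume "w \<in> Basis"
      then obtain i where w: "w = axis i 1" by (auto simp: Basis_vec_def)
      have "((\<lambda>s. u (x, s) $ i) has_real_derivative ut p $ i) (at t)"
        using time_derivative[of t x i] t at_within_Icc_at[of 0 t T] by (simp add: ut_def p)
      then show "((\<lambda>s. u (x, s) \<bullet> w) has_derivative (\<lambda>r. (r *\<^sub>R ut p) \<bullet> w)) (at t)"
        by (simp add: w inner_axis has_field_derivative_def mult.commute[of _ "ut p $ i"])
    qed
    then have "((\<lambda>y. u (x, y)) \<circ> (\<lambda>s. t + s) has_vector_derivative 1 *\<^sub>R ut p) (at 0)"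
      by (intro vector_diff_chain_at) (auto intro!: derivative_eq_intros)
    then show "((\<lambda>s. u (p + s *\<^sub>R (0, 1))) has_vector_derivative ut p) (at 0)"
      by (simp add: p o_def)
  qed
  have u0: "u (x, 0) = ubar x" if "x \<in> {a..b}" for x
    using that by (simp add: vec_eq_iff u_initial f(1))
  have eq: "ut (x, t) + A (x, t, u (x, t)) *v slope (x, t) = h (x, t, u (x, t))" if "(x, t) \<in> D" for x t
  proof -
    have "(x, t, u (x, t)) \<in> coeff_dom" using Dt[OF that] by (simp add: coeff_dom_def)
    then show ?thesis
      unfolding A[OF \<open>(x, t, u (x, t)) \<in> coeff_dom\<close>]
      by (simp add: vec_eq_iff ut_def diag_mat_mult lD[OF that] gD[OF that])
  qed
  have "C1_on D u"
    unfolding C1_on_def Basis_real_pair using contu ux ut by blast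
  then have "classical_solution a b D A h ubar u"
    unfolding classical_solution_def using ux ut eq u0 by blast
  moreover have unique: "\<forall>p\<in>D. v p = u p" if "classical_solution a b D A h ubar v" for v
  proof (rule classical_solution_unique[OF assms(1) T _ D_def A C1(1,2) contu u0 _ that])
    show "\<Lambda> \<ge> 0" using \<open>\<Lambda> > 0\<close> by simp
    fix x t i assume xt: "(x, t) \<in> D" and "0 < t"
    have t: "t \<in> {0..T}" using Dt[OF xt] by blast
    define X where "X = char u i t x"
    have X: "is_char u i X" "X t = x" using char[OF u(1) t] by (simp_all add: X_def)
    have near: "\<bar>X s - x\<bar> \<le> B * (t - s)" if "s \<in> {0..t}" for s
      using is_char_speed[OF X(1), of s t] that t X(2) by (simp add: abs_minus_commute)
    \<comment> \<open>backwards in time, the domain widens at speed \<open>B + 1\<close>, faster than a characteristic moves\<close>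
    have in_dom: "a + \<Lambda> * s \<le> X s - (t - s)" "X s + (t - s) \<le> b - \<Lambda> * s" if "s \<in> {0..t}" for s
      using near[OF that] xt unfolding D_def det_dom_def \<Lambda>_def by (auto simp: abs_le_iff algebra_simps)
    have D: "(X s, s) \<in> D" if "s \<in> {0..t}" for s
      using in_dom[OF that] that t by (auto simp: D_def det_dom_def)
    have der: "(X has_real_derivative \<mu> i (X s, s, u (X s, s))) (at s)"
      "((\<lambda>s. u (X s, s) $ i) has_real_derivative h (X s, s, u (X s, s)) $ i) (at s)"
      "(X s, s) \<in> interior D" if s: "s \<in> {0<..<t}" for s
    proof -
      have sT: "s \<in> {0..T}" "0 < s" "s < T" "s \<in> {0..t}" using s t by auto
      have at: "at s within {0..T} = at s" using sT by (intro at_within_Icc_at) auto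
      show "(X has_real_derivative \<mu> i (X s, s, u (X s, s))) (at s)"
        using X(1) sT(1) lD[OF D[OF sT(4)], of i] unfolding is_char_def by (metis at)
      show "((\<lambda>s. u (X s, s) $ i) has_real_derivative h (X s, s, u (X s, s)) $ i) (at s)"
        using u_along_char[OF X(1) sT(1)] gD[OF D[OF sT(4)], of i] by (simp add: at)
      show "(X s, s) \<in> interior D"
        unfolding D_def using in_dom[OF sT(4)] s sT by (intro interior_det_dom) auto
    qed
    have "continuous_on {0..t} X" using is_char_continuous[OF X(1)] t by (auto elim: continuous_on_subset)
    then show "\<exists>X. X t = x \<and> continuous_on {0..t} X \<and> (\<forall>s\<in>{0..t}. (X s, s) \<in> D) \<and>
      (\<forall>s\<in>{0<..<t}. (X s, s) \<in> interior D \<and> (X has_real_derivative \<mu> i (X s, s, u (X s, s))) (at s) \<and>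
        ((\<lambda>s. u (X s, s) $ i) has_real_derivative h (X s, s, u (X s, s)) $ i) (at s))"
      using X(2) D der by blast
  qed
  ultimately have "classical_solution a b D A h ubar u \<and>
      (\<forall>v w. classical_solution a b D A h ubar v \<longrightarrow> classical_solution a b D A h ubar w \<longrightarrow> (\<forall>p\<in>D. v p = w p))"
    by metis
  then show ?thesis using \<open>\<Lambda> > 0\<close> T(1) unfolding D_def by blast
qed

end
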